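(* Let $Z$ be an $H$-valued Lévy process such that for each $t\ge0$ the random variable $Z(t)$ is infinitely divisible with Lévy characteristics $[ta,t\Theta,tM]$, where $a\in H$, $\Theta$ is a nonnegative symmetric trace-class operator on $H$ and $M$ is a Lévy measure on $H\setminus\{0\}$. Let $\{\mathcal R(t)\}_{t\ge0}$ be the resolvent family of the Volterra equation $X(t)=\int_0^t a(t-\tau)AX(\tau)\,d\tau+X_0+Z(t)$. Then for each $t\ge0$ the stochastic convolution $Z_{\mathcal R}(t)=\int_0^t\mathcal R(t-\tau)\,dZ(\tau)$ is infinitely divisible with Lévy characteristics $[\alpha,Q,\mathcal M]$, where $$\alpha=\int_0^t\mathcal R(t-\tau)a\,d\tau+\int_0^t\!\!\int_H \mathcal R(t-\tau)x\,\big[\mathbf 1_{\{|\mathcal R(t-\tau)x|_H<1\}}-\mathbf 1_{\{|x|_H<1\}}\big]\,M(dx)\,d\tau,$$ $$Q=\int_0^t\mathcal R(t-\tau)\,\Theta\,\mathcal R^*(t-\tau)\,d\tau,\qquad \mathcal M(B)=\int_0^t M\big(\{x\in H:\ \mathcal R(t-\tau)x\in B\}\big)\,d\tau$$ for Borel sets $B\subset H\setminus\{0\}$.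
   Context: $H$ is a real separable Hilbert space with inner product $\langle\cdot,\cdot\rangle_H$ and norm $|\cdot|_H$. $A$ is a closed linear operator in $H$ with dense domain $\mathcal D(A)$, $a\in L^1_{\mathrm{loc}}(\mathbb R_+)$ (the kernel; not to be confused with the drift vector $a\in H$ above — the kernel appears only in the equation), and the equation is assumed well-posed with resolvent family $\{\mathcal R(t)\}_{t\ge0}$ of bounded operators, uniformly bounded on compact intervals, strongly continuous, $\mathcal R(0)=I$, satisfying $\mathcal R(t)x=x+\int_0^t a(t-\tau)A\mathcal R(\tau)x\,d\tau$ for $x\in\mathcal D(A)$. An $H$-valued Lévy process is a process with independent stationary increments, continuous in probability, càdlàg, with $Z(0)=0$. The stochastic convolution $\int_0^t\mathcal R(t-\tau)\,dZ(\tau)$ is defined as the limit in probability of $\sum_i\mathcal R(s_i)(Z(t-t_{i-1})-Z(t-t_i))$ over partitions $0=t_0<\dots<t_n=t$ with mesh $\to0$, $s_i\in[t_{i-1},t_i]$. Lévy characteristics $[\alpha,Q,\mathcal M]$ of an infinitely divisible $H$-valued random variable $Y$ mean $\mathbb E e^{i\langle y,Y\rangle_H}=\exp\big(i\langle\alpha,y\rangle_H-\tfrac12\langle Qy,y\rangle_H+\int_H(e^{i\langle y,x\rangle_H}-1-i\langle y,x\rangle_H\mathbf 1_{\{|x|_H<1\}})\mathcal M(dx)\big)$, $y\in H$. *)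

theory Defs
  imports "HOL-Probability.Probability"
begin

definition hadj :: "('h::real_inner \<Rightarrow> 'h) \<Rightarrow> 'h \<Rightarrow> 'h" where
  "hadj T y = (THE z. \<forall>x. inner (T x) y = inner x z)"

definition orthonormal_basis :: "'h::real_inner set \<Rightarrow> bool" where
  "orthonormal_basis B \<longleftrightarrow> (\<forall>e\<in>B. norm e = 1) \<and> (\<forall>e\<in>B. \<forall>f\<in>B. e \<noteq> f \<longrightarrow> inner e f = 0)
     \<and> closure (span B) = UNIV"

definition nonneg_sym_trace_class :: "('h::real_inner \<Rightarrow> 'h) \<Rightarrow> bool" where
  "nonneg_sym_trace_class T \<longleftrightarrow> bounded_linear T \<and> (\<forall>x y. inner (T x) y = inner x (T y))
     \<and> (\<forall>x. inner (T x) x \<ge> 0) \<and> (\<exists>B. orthonormal_basis B \<and> (\<lambda>e. inner (T e) e) summable_on B)"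

definition closed_dense_op :: "('h::real_normed_vector \<Rightarrow> 'h) \<Rightarrow> 'h set \<Rightarrow> bool" where
  "closed_dense_op A D \<longleftrightarrow> subspace D \<and> closure D = UNIV
     \<and> (\<forall>x\<in>D. \<forall>y\<in>D. A (x + y) = A x + A y) \<and> (\<forall>c. \<forall>x\<in>D. A (c *\<^sub>R x) = c *\<^sub>R A x)
     \<and> (\<forall>xs x y. (\<forall>n. xs n \<in> D) \<longrightarrow> xs \<longlonglongrightarrow> x \<longrightarrow> (\<lambda>n. A (xs n)) \<longlonglongrightarrow> y \<longrightarrow> x \<in> D \<and> A x = y)"

definition resolvent_family ::
  "(real \<Rightarrow> real) \<Rightarrow> ('h::{real_inner,complete_space,second_countable_topology} \<Rightarrow> 'h) \<Rightarrow> 'h set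
     \<Rightarrow> (real \<Rightarrow> 'h \<Rightarrow> 'h) \<Rightarrow> bool" where
  "resolvent_family k A D R \<longleftrightarrow>
     (\<forall>t\<ge>0. bounded_linear (R t))
   \<and> (\<forall>T\<ge>0. \<exists>C. \<forall>t\<in>{0..T}. \<forall>x. norm (R t x) \<le> C * norm x)
   \<and> (\<forall>x. continuous_on {0..} (\<lambda>t. R t x))
   \<and> (\<forall>x. R 0 x = x)
   \<and> (\<forall>x\<in>D. \<forall>t\<ge>0. (\<forall>s\<in>{0..t}. R s x \<in> D)
        \<and> set_integrable lborel {0..t} (\<lambda>s. k (t - s) *\<^sub>R A (R s x))
        \<and> R t x = x + (LINT s:{0..t}|lborel. k (t - s) *\<^sub>R A (R s x)))"

definition cadlag :: "(real \<Rightarrow> 'h::metric_space) \<Rightarrow> bool" where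
  "cadlag f \<longleftrightarrow> (\<forall>t\<ge>0. continuous (at_right t) f \<and> (t > 0 \<longrightarrow> (\<exists>l. (f \<longlongrightarrow> l) (at_left t))))"

definition levy_process ::
  "'a measure \<Rightarrow> (real \<Rightarrow> 'a \<Rightarrow> 'h::{real_inner,complete_space,second_countable_topology}) \<Rightarrow> bool" where
  "levy_process P Z \<longleftrightarrow> prob_space P
   \<and> (\<forall>t\<ge>0. Z t \<in> borel_measurable P)
   \<and> (\<forall>\<omega>\<in>space P. Z 0 \<omega> = 0)
   \<and> (\<forall>n (ts::nat \<Rightarrow> real). 0 \<le> ts 0 \<and> (\<forall>i<n. ts i < ts (Suc i)) \<longrightarrow>
        prob_space.indep_vars P (\<lambda>_. borel) (\<lambda>i \<omega>. Z (ts (Suc i)) \<omega> - Z (ts i) \<omega>) {..<n})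
   \<and> (\<forall>s\<ge>0. \<forall>t\<ge>0. distr P borel (\<lambda>\<omega>. Z (s + t) \<omega> - Z s \<omega>) = distr P borel (Z t))
   \<and> (\<forall>t\<ge>0. \<forall>e>0. ((\<lambda>s. measure P {\<omega>\<in>space P. dist (Z s \<omega>) (Z t \<omega>) > e}) \<longlongrightarrow> 0) (at t within {0..}))
   \<and> (\<forall>\<omega>\<in>space P. cadlag (\<lambda>t. Z t \<omega>))"

definition mconv :: "'h::{real_normed_vector,second_countable_topology} measure \<Rightarrow> 'h measure \<Rightarrow> 'h measure" where
  "mconv \<mu> \<nu> = distr (\<mu> \<Otimes>\<^sub>M \<nu>) borel (\<lambda>(x, y). x + y)"

fun mconv_pow :: "'h::{real_normed_vector,second_countable_topology} measure \<Rightarrow> nat \<Rightarrow> 'h measure" where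
  "mconv_pow \<mu> 0 = return borel 0"
| "mconv_pow \<mu> (Suc n) = mconv \<mu> (mconv_pow \<mu> n)"

definition infinitely_divisible ::
  "'a measure \<Rightarrow> ('a \<Rightarrow> 'h::{real_normed_vector,second_countable_topology}) \<Rightarrow> bool" where
  "infinitely_divisible P Y \<longleftrightarrow> (\<forall>n\<ge>1. \<exists>\<mu>. prob_space \<mu> \<and> sets \<mu> = sets borel
      \<and> distr P borel Y = mconv_pow \<mu> n)"

definition levy_measure :: "'h::real_normed_vector measure \<Rightarrow> bool" where
  "levy_measure M \<longleftrightarrow> sets M = sets borel \<and> emeasure M {0} = 0
     \<and> (\<integral>\<^sup>+x. ennreal (min 1 ((norm x)\<^sup>2)) \<partial>M) < \<infinity>"

definition levy_char ::
  "'a measure \<Rightarrow> ('a \<Rightarrow> 'h::{real_inner,complete_space,second_countable_topology}) \<Rightarrow> 'h \<Rightarrow> ('h \<Rightarrow> 'h)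
     \<Rightarrow> 'h measure \<Rightarrow> bool" where
  "levy_char P Y \<alpha> Q MM \<longleftrightarrow> (\<forall>y.
     (LINT \<omega>|P. exp (\<i> * complex_of_real (inner y (Y \<omega>)))) =
     exp (\<i> * complex_of_real (inner \<alpha> y) - complex_of_real (inner (Q y) y / 2)
          + (LINT x|MM. exp (\<i> * complex_of_real (inner y x)) - 1
                - \<i> * complex_of_real (inner y x) * complex_of_real (indicator {x. norm x < 1} x))))"

definition tagged_partition :: "real \<Rightarrow> real \<Rightarrow> nat \<Rightarrow> (nat \<Rightarrow> real) \<Rightarrow> (nat \<Rightarrow> real) \<Rightarrow> bool" where
  "tagged_partition t \<delta> n ts ss \<longleftrightarrow> n \<ge> 1 \<and> ts 0 = 0 \<and> ts n = t \<and> (\<forall>i<n. ts i < ts (Suc i))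
     \<and> (\<forall>i\<in>{1..n}. ts (i - 1) \<le> ss i \<and> ss i \<le> ts i \<and> ts i - ts (i - 1) < \<delta>)"

definition conv_sum ::
  "(real \<Rightarrow> 'h \<Rightarrow> 'h::real_normed_vector) \<Rightarrow> (real \<Rightarrow> 'a \<Rightarrow> 'h) \<Rightarrow> real \<Rightarrow> nat \<Rightarrow> (nat \<Rightarrow> real)
     \<Rightarrow> (nat \<Rightarrow> real) \<Rightarrow> 'a \<Rightarrow> 'h" where
  "conv_sum R Z t n ts ss \<omega> = (\<Sum>i\<in>{1..n}. R (ss i) (Z (t - ts (i - 1)) \<omega> - Z (t - ts i) \<omega>))"

text \<open>Y is the stochastic convolution int_0^t R(t-s) dZ(s): the limit in probability of the
  Riemann sums as the mesh tends to 0 (for t = 0 the empty integral, i.e. 0).\<close>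
definition is_stoch_conv ::
  "'a measure \<Rightarrow> (real \<Rightarrow> 'h \<Rightarrow> 'h::real_normed_vector) \<Rightarrow> (real \<Rightarrow> 'a \<Rightarrow> 'h) \<Rightarrow> real \<Rightarrow> ('a \<Rightarrow> 'h) \<Rightarrow> bool" where
  "is_stoch_conv P R Z t Y \<longleftrightarrow>
     (if t = 0 then (AE \<omega> in P. Y \<omega> = 0)
      else (\<forall>e>0. \<exists>\<delta>>0. \<forall>n ts ss. tagged_partition t \<delta> n ts ss \<longrightarrow>
              measure P {\<omega>\<in>space P. dist (conv_sum R Z t n ts ss \<omega>) (Y \<omega>) > e} < e))"

end

theory Submission
  imports Defs
begin

text \<open>
  Let \<open>\<psi>\<close> be the Levy exponent of \<open>Z 1\<close>, and consider the Riemann sums of the convolution over dyadic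
  partitions. By independence and stationarity of the increments, the characteristic function of such
  a sum at \<open>y\<close> is \<open>exp\<close> of a Riemann sum of \<open>s \<mapsto> \<psi> (R(t - s)\<^sup>* y)\<close>. The path \<open>s \<mapsto> R(t - s)\<^sup>* y\<close> is only
  weakly continuous, but \<open>\<psi>\<close> is weakly sequentially continuous, so that in the limit
  \<open>E exp (i \<langle>y, Y\<rangle>) = exp (\<integral>\<^sub>0\<^sup>t \<psi> (R(t - s)\<^sup>* y) ds)\<close>. Fubini's theorem turns the exponent into the claimed
  triplet; the second term of the drift compensates the change of the truncation function from
  \<open>|x| < 1\<close> to \<open>|R(t - s) x| < 1\<close>.

  For infinite divisibility, slow the process down to \<open>Z(s/n)\<close>. A Riemann sum of \<open>Z\<close> is distributed as a
  sum of \<open>n\<close> independent copies of the corresponding sum of \<open>Z(s/n)\<close>. If a sum of \<open>n\<close> independent copies is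
  small in probability, then so is each of them; hence the sums of \<open>Z(s/n)\<close> are Cauchy in probability,
  and the law of their limit is an \<open>n\<close>-th convolution root of the law of \<open>Y\<close>.
\<close>

section \<open>Adjoints and weak measurability in Hilbert space\<close>

text \<open>The slowed process is never constructed. On the grid of step \<open>\<delta>\<close>,
  \<open>N * n\<close> increments are grouped in two ways: \<open>n\<close> consecutive ones form
  one increment over a step \<open>n * \<delta>\<close>, while the residue classes modulo
  \<open>n\<close> form \<open>n\<close> independent sums, each with the law of one slow Riemann
  sum. Only laws are compared, so it is enough to alter the step and keep the operators. The limit
  of the slow sums is not given and must come from completeness. The nesting of the dyadic grids
  serves this: the difference of two levels is itself one Riemann sum on the finer grid, so the
  estimate for a single copy applies to it.

  On the analytic side the delicate term of \<open>\<psi>\<close> is the quadratic form of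
  \<open>\<Theta>\<close>, since for a general bounded operator such a form is not weakly
  continuous. The drift and the jump integral converge directly; the law of \<open>Z 1\<close> then
  forces the convergence of the remaining term. Measurability of the adjoint path and of the drift
  correction is tested on inner products.\<close>

lemma riesz_representation:
  fixes f :: "'h::{real_inner,complete_space} \<Rightarrow> real"
  assumes f: "bounded_linear f"
  obtains z where "\<And>x. f x = inner x z"
proof -
  interpret f: bounded_linear f by fact
  \<comment> \<open>The representing vector is the minimiser of this quadratic functional.
    Completing the square bounds it below, the parallelogram identity \<open>par\<close> makes
    minimising sequences Cauchy, and stationarity at the minimiser is the representation.\<close>
  define J where "J x = (norm x)\<^sup>2 / 2 - f x" for x
  obtain K where K: "\<And>x. norm (f x) \<le> norm x * K" using f.bounded by blast
  have J_bound: "- (K\<^sup>2 / 2) \<le> J x" for x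
  proof -
    have "f x \<le> norm x * K" using K[of x] by simp
    moreover have "0 \<le> (norm x - K)\<^sup>2" by simp
    ultimately show ?thesis unfolding J_def power2_diff by (simp add: field_simps)
  qed
  define m where "m = Inf (range J)"
  have bdd: "bdd_below (range J)" using J_bound by (auto intro!: bdd_belowI)
  have m_le: "m \<le> J x" for x
    unfolding m_def by (rule cInf_lower[OF _ bdd]) auto
  have "\<exists>x. J x < m + 1 / real (Suc n)" for n
    using cInf_lessD[of "range J" "m + 1 / real (Suc n)"] by (auto simp: m_def)
  then obtain X where X: "\<And>n. J (X n) < m + 1 / real (Suc n)" by metis
  have par: "(norm (x - y))\<^sup>2 = 4 * (J x + J y - 2 * J ((1/2) *\<^sub>R (x + y)))" for x y
    unfolding J_def power2_norm_eq_inner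
    by (simp add: f.add f.scaleR inner_add inner_diff inner_commute algebra_simps)
  have dist: "(norm (X i - X j))\<^sup>2 \<le> 4 * (1 / real (Suc i) + 1 / real (Suc j))" for i j
  proof -
    have "J (X i) + J (X j) - 2 * J ((1/2) *\<^sub>R (X i + X j))
        \<le> (m + 1 / real (Suc i)) + (m + 1 / real (Suc j)) - 2 * m"
      by (intro diff_mono add_mono mult_left_mono less_imp_le[OF X] m_le) simp
    then show ?thesis unfolding par by simp
  qed
  have "Cauchy X"
  proof (rule metric_CauchyI)
    fix e :: real assume e: "e > 0"
    obtain N where N: "1 / real (Suc N) < e\<^sup>2 / 8"
      using reals_Archimedean[of "e\<^sup>2 / 8"] e by (auto simp: inverse_eq_divide)
    show "\<exists>N. \<forall>i\<ge>N. \<forall>j\<ge>N. dist (X i) (X j) < e"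
    proof (intro exI allI impI)
      fix i j assume "i \<ge> N" "j \<ge> N"
      then have "1 / real (Suc i) \<le> 1 / real (Suc N)" "1 / real (Suc j) \<le> 1 / real (Suc N)"
        by (auto simp: frac_le)
      then have "(norm (X i - X j))\<^sup>2 < e\<^sup>2"
        using N by (intro order.strict_trans1[OF dist[of i j]]) argo
      then show "dist (X i) (X j) < e" using e by (simp add: dist_norm power2_less_imp_less)
    qed
  qed
  then obtain z where z: "X \<longlonglongrightarrow> z" using Cauchy_convergent convergent_def by blast
  have "(\<lambda>n. J (X n)) \<longlonglongrightarrow> J z"
    unfolding J_def by (intro tendsto_intros f.tendsto z) simp
  moreover have "(\<lambda>n. m + 1 / real (Suc n)) \<longlonglongrightarrow> m"
    using tendsto_add[OF tendsto_const LIMSEQ_Suc[OF lim_1_over_n], of m] by simp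
  ultimately have "J z \<le> m"
    by (rule LIMSEQ_le) (use X less_imp_le in blast)
  then have min: "J z \<le> J x" for x using m_le[of x] by linarith
  have "f v = inner v z" for v
  proof (cases "v = 0")
    case False
    define d where "d = inner z v - f v"
    \<comment> \<open>The exact minimiser of the quadratic function s -> J(z + s v). The drop it
      achieves is proportional to the square of \<open>d\<close>, so minimality of \<open>z\<close>
      forces \<open>d = 0\<close>.\<close>
    define s where "s = - d / (norm v)\<^sup>2"
    have "J (z + s *\<^sub>R v) - J z = s * d + s\<^sup>2 * (norm v)\<^sup>2 / 2"
      unfolding J_def d_def power2_norm_eq_inner
      by (simp add: f.add f.scaleR inner_add inner_commute algebra_simps power2_eq_square)
    also have "\<dots> = - (d\<^sup>2 / (norm v)\<^sup>2 / 2)"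
      using False by (simp add: s_def power2_eq_square field_simps)
    finally have "0 \<le> - (d\<^sup>2 / (norm v)\<^sup>2 / 2)"
      using min[of "z + s *\<^sub>R v"] by (metis diff_ge_0_iff_ge)
    then have "d\<^sup>2 / (norm v)\<^sup>2 \<le> 0" by simp
    then have "d = 0" using False by (simp add: divide_le_0_iff)
    then show ?thesis by (simp add: d_def inner_commute)
  qed simp
  then show thesis using that by blast
qed

text \<open>\<open>hadj\<close> is a definite description: Riesz representation supplies existence,
  and a vector orthogonal to everything is zero, which gives uniqueness.\<close>

lemma inner_hadj:
  fixes T :: "'h::{real_inner,complete_space} \<Rightarrow> 'h"
  assumes "bounded_linear T"
  shows "inner (T x) y = inner x (hadj T y)"
proof -
  have "bounded_linear (\<lambda>x. inner (T x) y)"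
    using bounded_linear_compose[OF bounded_linear_inner_left assms] .
  from riesz_representation[OF this] obtain z where z: "\<And>x. inner (T x) y = inner x z" by blast
  have "hadj T y = z"
    unfolding hadj_def
  proof (rule the_equality)
    fix w assume "\<forall>x. inner (T x) y = inner x w"
    then have "inner x (w - z) = 0" for x by (simp add: z inner_diff_right)
    then have "w - z = 0" using inner_eq_zero_iff by blast
    then show "w = z" by simp
  qed (use z in simp)
  then show ?thesis using z by simp
qed

lemma norm_hadj_le:
  fixes T :: "'h::{real_inner,complete_space} \<Rightarrow> 'h"
  assumes T: "bounded_linear T" and C: "\<And>x. norm (T x) \<le> C * norm x"
  shows "norm (hadj T y) \<le> C * norm y"
proof -
  let ?z = "hadj T y"
  have "norm ?z * norm ?z = inner (T ?z) y"
    by (simp add: inner_hadj[OF T] power2_norm_eq_inner flip: power2_eq_square)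
  also have "\<dots> \<le> norm (T ?z) * norm y" by (rule norm_cauchy_schwarz)
  also have "\<dots> \<le> C * norm ?z * norm y" by (intro mult_right_mono C) simp
  finally have "norm ?z * norm ?z \<le> norm ?z * (C * norm y)" by (simp add: mult_ac)
  \<comment> \<open>No sign of \<open>C\<close> is assumed. The assumed bound at \<open>y\<close>
    itself gives this one, which covers the case \<open>norm ?z = 0\<close>.\<close>
  moreover have "0 \<le> C * norm y"
    using C[of y] norm_ge_zero[of "T y"] by linarith
  ultimately show ?thesis by (cases "norm ?z = 0") (auto simp: mult_le_cancel_left)
qed

text \<open>An open set is a countable union of closed balls with centres in a dense set and
  rational radii. Closed balls are the convenient test sets because a bound "at most r" on a norm
  can be checked by countably many linear inequalities.\<close>

lemma borel_measurable_cballI: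
  fixes f :: "'a \<Rightarrow> 'b::{metric_space,second_countable_topology}"
  assumes "\<And>c r. {x\<in>space M. dist c (f x) \<le> r} \<in> sets M"
  shows "f \<in> borel_measurable M"
proof (rule borel_measurableI)
  fix U :: "'b set" assume "open U"
  obtain D :: "'b set" where D: "countable D" "\<And>X. open X \<Longrightarrow> X \<noteq> {} \<Longrightarrow> \<exists>d\<in>D. d \<in> X"
    using countable_dense_setE by metis
  let ?I = "{(d, q). d \<in> D \<and> q \<in> \<rat> \<and> cball d q \<subseteq> U}"
  have count: "countable ?I"
    by (rule countable_subset[of _ "D \<times> \<rat>"]) (auto simp: D(1) countable_rat)
  have "f -` U \<inter> space M = (\<Union>(d, q)\<in>?I. {x\<in>space M. dist d (f x) \<le> q})"
  proof (intro set_eqI iffI)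
    fix x assume x: "x \<in> f -` U \<inter> space M"
    then obtain e where e: "e > 0" "ball (f x) e \<subseteq> U"
      using \<open>open U\<close> by (auto simp: open_contains_ball)
    obtain q where q: "q \<in> \<rat>" "0 < q" "q < e / 2"
      using Rats_dense_in_real[of 0 "e / 2"] e by auto
    obtain d where d: "d \<in> D" "dist (f x) d < q"
      using D(2)[of "ball (f x) q"] q by (auto simp: mem_ball)
    have "cball d q \<subseteq> ball (f x) e"
    proof
      fix y assume "y \<in> cball d q"
      then show "y \<in> ball (f x) e" using dist_triangle[of "f x" y d] d q by simp
    qed
    then show "x \<in> (\<Union>(d, q)\<in>?I. {x\<in>space M. dist d (f x) \<le> q})"
      using x e d q by (intro UN_I[of "(d, q)"]) (auto simp: dist_commute)
  qed auto
  also have "\<dots> \<in> sets M"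
    by (rule sets.countable_UN'[OF count]) (auto intro: assms)
  finally show "f -` U \<inter> space M \<in> sets M" .
qed

text \<open>The Hilbert space case of Pettis' theorem: by separability, |w| <= r is equivalent to
  <w, d> <= r |d| for all \<open>d\<close> in a countable dense set.\<close>

lemma borel_measurable_weakI:
  fixes f :: "'a \<Rightarrow> 'h::{real_inner,second_countable_topology}"
  assumes [measurable]: "\<And>z. (\<lambda>x. inner (f x) z) \<in> borel_measurable M"
  shows "f \<in> borel_measurable M"
proof (rule borel_measurable_cballI)
  fix c r
  obtain D :: "'h set" where D: "countable D" "\<And>X. open X \<Longrightarrow> X \<noteq> {} \<Longrightarrow> \<exists>d\<in>D. d \<in> X"
    using countable_dense_setE by metis
  have dense: "closure D = UNIV"
    by (metis D(2) closure_eq_empty closure_interior compl_bot_eq double_compl equals0D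
        interior_subset open_interior subsetD ComplD)
  have norm_le: "norm w \<le> r \<longleftrightarrow> (\<forall>d\<in>D. inner w d \<le> r * norm d)" if "0 \<le> r" for w :: 'h
  proof
    assume "norm w \<le> r"
    then show "\<forall>d\<in>D. inner w d \<le> r * norm d"
      using norm_cauchy_schwarz mult_right_mono norm_ge_zero order_trans by metis
  next
    assume *: "\<forall>d\<in>D. inner w d \<le> r * norm d"
    have "closed {d. inner w d \<le> r * norm d}"
      by (intro closed_Collect_le continuous_intros)
    then have all: "inner w d \<le> r * norm d" for d
      using closure_minimal[of D "{d. inner w d \<le> r * norm d}"] * dense by auto
    show "norm w \<le> r"
      using all[of w] that by (cases "w = 0") (simp_all add: power2_norm_eq_inner[symmetric] power2_eq_square)
  qed
  show "{x\<in>space M. dist c (f x) \<le> r} \<in> sets M"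
  proof (cases "0 \<le> r")
    case True
    have "{x\<in>space M. dist c (f x) \<le> r} =
        {x\<in>space M. \<forall>d\<in>D. inner (f x) d - inner c d \<le> r * norm d}"
      by (auto simp: dist_norm norm_minus_commute[of c] norm_le[OF True] inner_diff_left)
    also have "\<dots> \<in> sets M" using D(1) by measurable
    finally show ?thesis .
  next
    case False
    then have "{x\<in>space M. dist c (f x) \<le> r} = {}"
      using zero_le_dist order_trans by blast
    then show ?thesis by (metis sets.empty_sets)
  qed
qed

section \<open>Independent sums and almost sure limits\<close>

text \<open>Closed sets form an intersection-stable generator of the Borel sets, and the indicator
  of a closed set is a pointwise limit of continuous functions with values in [0, 1].\<close>

lemma measure_eqI_bounded_continuous:
  fixes \<mu> \<nu> :: "'a::metric_space measure"
  assumes "prob_space \<mu>" "prob_space \<nu>" and sets: "sets \<mu> = sets borel" "sets \<nu> = sets borel"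
    and eq: "\<And>f :: 'a \<Rightarrow> real. continuous_on UNIV f \<Longrightarrow> (\<And>x. 0 \<le> f x \<and> f x \<le> 1) \<Longrightarrow>
      (LINT x|\<mu>. f x) = (LINT x|\<nu>. f x)"
  shows "\<mu> = \<nu>"
proof (rule measure_eqI_generator_eq[where E="Collect closed" and \<Omega>=UNIV and A="\<lambda>_. UNIV"])
  interpret \<mu>: prob_space \<mu> by fact
  interpret \<nu>: prob_space \<nu> by fact
  note [measurable_cong] = sets
  show "Int_stable (Collect closed)" by (auto simp: Int_stable_def)
  show "sets \<mu> = sigma_sets UNIV (Collect closed)" "sets \<nu> = sigma_sets UNIV (Collect closed)"
    using sets by (auto simp: borel_eq_closed)
  show "emeasure \<mu> UNIV \<noteq> \<infinity>" by simp
  fix F :: "'a set" assume "F \<in> Collect closed"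
  then have F: "closed F" by simp
  have [measurable]: "F \<in> sets borel" using F by simp
  show "emeasure \<mu> F = emeasure \<nu> F"
  proof (cases "F = {}")
    case False
    define f where "f k x = max 0 (1 - real k * infdist x F)" for k x
    have cont: "continuous_on UNIV (f k)" for k
      unfolding f_def by (intro continuous_intros)
    then have [measurable]: "f k \<in> borel_measurable borel" for k
      by (rule borel_measurable_continuous_onI)
    have bound: "0 \<le> f k x \<and> f k x \<le> 1" for k x
      by (auto simp: f_def infdist_nonneg)
    have lim: "(\<lambda>k. f k x) \<longlonglongrightarrow> indicator F x" for x
    proof (cases "x \<in> F")
      case True
      then show ?thesis by (simp add: f_def)
    next
      case False
      then have pos: "infdist x F > 0"
        using in_closed_iff_infdist_zero[OF F \<open>F \<noteq> {}\<close>] infdist_nonneg[of x F] by fastforce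
      obtain K where K: "1 / infdist x F < real K" using reals_Archimedean2 by blast
      have "f k x = 0" if "k \<ge> K" for k
      proof -
        have "1 < real K * infdist x F" using K pos by (simp add: field_simps)
        also have "\<dots> \<le> real k * infdist x F" using that pos by (intro mult_right_mono) auto
        finally show ?thesis by (simp add: f_def)
      qed
      then have "eventually (\<lambda>k. f k x = 0) sequentially"
        by (auto simp: eventually_sequentially)
      then show ?thesis using False by (simp add: tendsto_eventually)
    qed
    have "(\<lambda>k. LINT x|\<mu>. f k x) \<longlonglongrightarrow> (LINT x|\<mu>. indicator F x)"
      by (rule integral_dominated_convergence[where w="\<lambda>_. 1"]) (use lim bound in auto)
    moreover have "(\<lambda>k. LINT x|\<nu>. f k x) \<longlonglongrightarrow> (LINT x|\<nu>. indicator F x)"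
      by (rule integral_dominated_convergence[where w="\<lambda>_. 1"]) (use lim bound in auto)
    ultimately have "(LINT x|\<mu>. indicator F x) = (LINT x|\<nu>. indicator F x :: real)"
      using eq[OF cont bound] by (simp add: LIMSEQ_unique)
    then show ?thesis
      by (simp add: \<mu>.emeasure_eq_measure \<nu>.emeasure_eq_measure sets sets_eq_imp_space_eq)
  qed simp
qed auto

text \<open>The two sequences may live on different probability spaces. This is essential later,
  where one of them consists of sums of copies on a product space.\<close>

lemma distr_eq_of_AE_limits:
  fixes X :: "'a \<Rightarrow> 'c::{metric_space,second_countable_topology}" and X' :: "'b \<Rightarrow> 'c"
  assumes M: "prob_space M" "prob_space M'"
    and [measurable]: "\<And>k. Xs k \<in> borel_measurable M" "X \<in> borel_measurable M"
      "\<And>k. Xs' k \<in> borel_measurable M'" "X' \<in> borel_measurable M'"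
    and lim: "AE x in M. (\<lambda>k. Xs k x) \<longlonglongrightarrow> X x" "AE x in M'. (\<lambda>k. Xs' k x) \<longlonglongrightarrow> X' x"
    and eq: "\<And>k. distr M borel (Xs k) = distr M' borel (Xs' k)"
  shows "distr M borel X = distr M' borel X'"
proof (rule measure_eqI_bounded_continuous)
  interpret M: prob_space M by fact
  interpret M': prob_space M' by fact
  show "prob_space (distr M borel X)" "prob_space (distr M' borel X')"
    by (auto intro: M.prob_space_distr M'.prob_space_distr)
  fix f :: "'c \<Rightarrow> real" assume f: "continuous_on UNIV f" "\<And>x. 0 \<le> f x \<and> f x \<le> 1"
  have [measurable]: "f \<in> borel_measurable borel"
    using f(1) by (rule borel_measurable_continuous_onI)
  have f_lim: "(\<lambda>k. f (u k)) \<longlonglongrightarrow> f v" if "u \<longlonglongrightarrow> v" for u v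
    using continuous_on_tendsto_compose[OF f(1) that] by simp
  have "(\<lambda>k. LINT x|M. f (Xs k x)) \<longlonglongrightarrow> (LINT x|M. f (X x))"
    by (rule integral_dominated_convergence[where w="\<lambda>_. 1"])
       (use f lim(1) in \<open>auto intro: f_lim\<close>)
  moreover have "(\<lambda>k. LINT x|M'. f (Xs' k x)) \<longlonglongrightarrow> (LINT x|M'. f (X' x))"
    by (rule integral_dominated_convergence[where w="\<lambda>_. 1"])
       (use f lim(2) in \<open>auto intro: f_lim\<close>)
  moreover have "(LINT x|M. f (Xs k x)) = (LINT x|M'. f (Xs' k x))" for k
    using arg_cong[OF eq[of k], of "\<lambda>D. LINT x|D. f x"] by (simp add: integral_distr)
  ultimately show "(LINT x|distr M borel X. f x) = (LINT x|distr M' borel X'. f x)"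
    by (simp add: integral_distr LIMSEQ_unique)
qed simp_all

section \<open>Sums of independent vectors and Borel-Cantelli arguments\<close>

context prob_space
begin

text \<open>Serves both groupings of the fine increments: offsets inside consecutive blocks, and
  residue classes.\<close>

lemma indep_vars_block_sums:
  fixes D :: "'i \<Rightarrow> 'a \<Rightarrow> 'h::{real_normed_vector,second_countable_topology}"
  assumes "indep_vars (\<lambda>_. borel) D I" "\<And>j. j \<in> L \<Longrightarrow> K j \<subseteq> I" "disjoint_family_on K L"
  shows "indep_vars (\<lambda>_. borel) (\<lambda>j \<omega>. \<Sum>i\<in>K j. D i \<omega>) L"
proof -
  have "indep_vars (\<lambda>_. borel) (\<lambda>j \<omega>. (\<lambda>f. \<Sum>i\<in>K j. f i) (\<lambda>i\<in>K j. D i \<omega>)) L"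
    by (rule indep_vars_compose2[OF indep_vars_restrict[OF assms]]) measurable
  then show ?thesis by simp
qed

text \<open>The resulting law depends on the index set only through its cardinality, so index sets
  of equal size may be exchanged.\<close>

lemma distr_sum_indep_identical:
  fixes D :: "'i \<Rightarrow> 'a \<Rightarrow> 'h::{real_normed_vector,second_countable_topology}"
  assumes "finite I" "indep_vars (\<lambda>_. borel) D I" "\<And>i. i \<in> I \<Longrightarrow> distr M borel (D i) = \<mu>"
  shows "distr M borel (\<lambda>\<omega>. \<Sum>i\<in>I. D i \<omega>) = mconv_pow \<mu> (card I)"
  using assms
proof (induction I rule: finite_induct)
  case empty
  show ?case by simp
next
  case (insert x F)
  have "indep_var borel ((\<lambda>f. f x) \<circ> (\<lambda>\<omega>. \<lambda>i\<in>{x}. D i \<omega>))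
      borel ((\<lambda>f. \<Sum>i\<in>F. f i) \<circ> (\<lambda>\<omega>. \<lambda>i\<in>F. D i \<omega>))"
    by (rule indep_var_compose[OF indep_var_restrict[OF insert.prems(1)]])
       (use insert.hyps in auto)
  then have "indep_var borel (D x) borel (\<lambda>\<omega>. \<Sum>i\<in>F. D i \<omega>)" by (simp add: comp_def)
  then have meas [measurable]: "D x \<in> borel_measurable M" "(\<lambda>\<omega>. \<Sum>i\<in>F. D i \<omega>) \<in> borel_measurable M"
    and pair: "distr M borel (D x) \<Otimes>\<^sub>M distr M borel (\<lambda>\<omega>. \<Sum>i\<in>F. D i \<omega>)
      = distr M (borel \<Otimes>\<^sub>M borel) (\<lambda>\<omega>. (D x \<omega>, \<Sum>i\<in>F. D i \<omega>))"
    by (auto simp: indep_var_distribution_eq)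
  have IH: "distr M borel (\<lambda>\<omega>. \<Sum>i\<in>F. D i \<omega>) = mconv_pow \<mu> (card F)"
    using insert.prems by (intro insert.IH indep_vars_subset[OF insert.prems(1)]) auto
  have \<mu>: "distr M borel (D x) = \<mu>" using insert.prems by simp
  have "distr M borel (\<lambda>\<omega>. D x \<omega> + (\<Sum>i\<in>F. D i \<omega>)) =
      distr (distr M (borel \<Otimes>\<^sub>M borel) (\<lambda>\<omega>. (D x \<omega>, \<Sum>i\<in>F. D i \<omega>))) borel (\<lambda>(x, y). x + y)"
    by (subst distr_distr) (auto simp: comp_def)
  also have "\<dots> = mconv_pow \<mu> (card (insert x F))"
    using insert.hyps by (simp add: mconv_def IH \<mu> flip: pair)
  finally show ?case using insert.hyps by simp
qed

text \<open>The joint law of an independent family is the product of its marginals, so equal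
  marginals give equal laws of any measurable function of the family. The product description asks
  for a nonempty index set, hence the case split.\<close>

lemma distr_sum_indep_cong:
  fixes D E :: "'i \<Rightarrow> 'a \<Rightarrow> 'h::{real_normed_vector,second_countable_topology}"
  assumes D: "indep_vars (\<lambda>_. borel) D I" and E: "indep_vars (\<lambda>_. borel) E I"
    and eq: "\<And>i. i \<in> I \<Longrightarrow> distr M borel (D i) = distr M borel (E i)"
    and [measurable]: "\<And>i. i \<in> I \<Longrightarrow> T i \<in> borel_measurable borel"
  shows "distr M borel (\<lambda>\<omega>. \<Sum>i\<in>I. T i (D i \<omega>) :: 'h) = distr M borel (\<lambda>\<omega>. \<Sum>i\<in>I. T i (E i \<omega>))"
proof (cases "I = {}")
  case False
  have [measurable]: "D i \<in> borel_measurable M" "E i \<in> borel_measurable M" if "i \<in> I" for i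
    using D E that by (auto simp: indep_vars_def)
  have law: "distr M borel (\<lambda>\<omega>. \<Sum>i\<in>I. T i (X i \<omega>)) =
      distr (\<Pi>\<^sub>M i\<in>I. distr M borel (X i)) borel (\<lambda>f. \<Sum>i\<in>I. T i (f i))"
    if X: "indep_vars (\<lambda>_. borel) X I" for X :: "'i \<Rightarrow> 'a \<Rightarrow> 'h"
  proof -
    have [measurable]: "X i \<in> borel_measurable M" if "i \<in> I" for i
      using X that by (auto simp: indep_vars_def)
    have "distr M borel (\<lambda>\<omega>. \<Sum>i\<in>I. T i (X i \<omega>)) =
        distr (distr M (\<Pi>\<^sub>M i\<in>I. borel) (\<lambda>x. \<lambda>i\<in>I. X i x)) borel (\<lambda>f. \<Sum>i\<in>I. T i (f i))"
      by (subst distr_distr) (auto simp: comp_def)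
    also have "distr M (\<Pi>\<^sub>M i\<in>I. borel) (\<lambda>x. \<lambda>i\<in>I. X i x) = (\<Pi>\<^sub>M i\<in>I. distr M borel (X i))"
      using X False by (subst indep_vars_iff_distr_eq_PiM'[symmetric]) auto
    finally show ?thesis .
  qed
  have "(\<Pi>\<^sub>M i\<in>I. distr M borel (D i)) = (\<Pi>\<^sub>M i\<in>I. distr M borel (E i))"
    by (intro PiM_cong eq refl)
  then show ?thesis by (simp add: law[OF D] law[OF E])
qed simp

text \<open>Realises a convolution power by the coordinate copies of \<open>V\<close> on an explicit
  product space. There almost sure limits can be taken copy by copy.\<close>

lemma mconv_pow_distr:
  fixes V :: "'a \<Rightarrow> 'h::{real_normed_vector,second_countable_topology}"
  assumes [measurable]: "V \<in> borel_measurable M" and n: "n \<ge> 1"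
  shows "mconv_pow (distr M borel V) n = distr (PiM {..<n} (\<lambda>_. M)) borel (\<lambda>\<omega>. \<Sum>j<n. V (\<omega> j))"
proof -
  interpret Pi: product_prob_space "\<lambda>_. M" "{..<n}" ..
  have comp: "distr (PiM {..<n} (\<lambda>_. M)) M (\<lambda>\<omega>. \<omega> i) = M" if "i \<in> {..<n}" for i
    using that by (intro distr_PiM_component prob_space_axioms)
  have "distr (PiM {..<n} (\<lambda>_. M)) (PiM {..<n} (\<lambda>_. M)) (\<lambda>\<omega>. \<lambda>i\<in>{..<n}. \<omega> i)
      = distr (PiM {..<n} (\<lambda>_. M)) (PiM {..<n} (\<lambda>_. M)) (\<lambda>\<omega>. \<omega>)"
    by (intro distr_cong refl) (auto simp: space_PiM PiE_restrict)
  also have "\<dots> = (\<Pi>\<^sub>M i\<in>{..<n}. distr (PiM {..<n} (\<lambda>_. M)) M (\<lambda>\<omega>. \<omega> i))"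
    unfolding distr_id2[OF refl] by (intro PiM_cong refl) (simp add: comp)
  finally have "Pi.indep_vars (\<lambda>_. M) (\<lambda>i \<omega>. \<omega> i) {..<n}"
    using n by (subst Pi.indep_vars_iff_distr_eq_PiM') (auto simp: lessThan_empty_iff)
  then have "Pi.indep_vars (\<lambda>_. borel) (\<lambda>i \<omega>. V (\<omega> i)) {..<n}"
    by (rule Pi.indep_vars_compose2) measurable
  moreover have "distr (PiM {..<n} (\<lambda>_. M)) borel (\<lambda>\<omega>. V (\<omega> i)) = distr M borel V" if "i \<in> {..<n}" for i
  proof -
    have "distr (PiM {..<n} (\<lambda>_. M)) borel (\<lambda>\<omega>. V (\<omega> i)) =
        distr (distr (PiM {..<n} (\<lambda>_. M)) M (\<lambda>\<omega>. \<omega> i)) borel V"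
      using that by (subst distr_distr) (auto simp: comp_def)
    then show ?thesis using comp[OF that] by simp
  qed
  ultimately show ?thesis
    using Pi.distr_sum_indep_identical[of "{..<n}" "\<lambda>i \<omega>. V (\<omega> i)"] by simp
qed

text \<open>Borel-Cantelli: the exceptional probabilities are summable, and the tolerances that hold
  eventually tend to 0.\<close>

lemma AE_tendsto_of_geometric:
  fixes X :: "nat \<Rightarrow> 'a \<Rightarrow> 'b::{metric_space,second_countable_topology}"
  assumes [measurable]: "\<And>k. X k \<in> borel_measurable M" "Y \<in> borel_measurable M"
    and small: "\<And>k. prob {\<omega>\<in>space M. dist (X k \<omega>) (Y \<omega>) > (1/2)^k} \<le> (1/2)^k"
  shows "AE \<omega> in M. (\<lambda>k. X k \<omega>) \<longlonglongrightarrow> Y \<omega>"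
proof -
  let ?A = "\<lambda>k. {\<omega>\<in>space M. dist (X k \<omega>) (Y \<omega>) > (1/2)^k}"
  have "summable (\<lambda>k. prob (?A k))"
    by (rule summable_comparison_test'[OF summable_geometric[of "1/2::real"], where N=0])
       (use small in auto)
  then have "AE \<omega> in M. eventually (\<lambda>k. \<omega> \<in> space M - ?A k) sequentially"
    by (intro borel_cantelli_AE1) (auto simp: emeasure_eq_measure)
  then show ?thesis
  proof eventually_elim
    case (elim \<omega>)
    then have "eventually (\<lambda>k. dist (X k \<omega>) (Y \<omega>) \<le> (1/2)^k) sequentially"
      by eventually_elim auto
    then have "(\<lambda>k. dist (X k \<omega>) (Y \<omega>)) \<longlonglongrightarrow> 0"
      by (intro tendsto_sandwich[OF _ _ tendsto_const LIMSEQ_power_zero[of "1/2::real"]]) auto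
    then show ?case by (rule iffD2[OF tendsto_dist_iff])
  qed
qed

lemma geometric_subsequence:
  assumes "\<And>e::real. e > 0 \<Longrightarrow> \<exists>m::nat. \<forall>k\<ge>m. prob {\<omega>\<in>space M. dist (X k \<omega>) (Y \<omega>) > e} < e"
  obtains r where "strict_mono r"
    "\<And>j. prob {\<omega>\<in>space M. dist (X (r j) \<omega>) (Y \<omega>) > (1/2)^j} \<le> (1/2)^j"
proof -
  have "\<forall>j. \<exists>m. \<forall>k\<ge>m. prob {\<omega>\<in>space M. dist (X k \<omega>) (Y \<omega>) > (1/2)^j} < (1/2)^j"
    using assms by simp
  then obtain m where m: "\<And>j k. k \<ge> m j \<Longrightarrow> prob {\<omega>\<in>space M. dist (X k \<omega>) (Y \<omega>) > (1/2)^j} < (1/2)^j"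
    by metis
  \<comment> \<open>The summand \<open>j\<close> makes \<open>r\<close> strictly increasing, and the
    sum over all \<open>i \<le> j\<close> dominates \<open>m j\<close>; the thresholds
    \<open>m\<close> themselves need not be monotone.\<close>
  define r where "r j = j + (\<Sum>i\<le>j. m i)" for j :: nat
  have r: "m j \<le> r j" for j unfolding r_def by (intro trans_le_add2 member_le_sum) auto
  show thesis
  proof (rule that[of r])
    show "strict_mono r" by (auto simp: strict_mono_Suc_iff r_def)
    show "prob {\<omega>\<in>space M. dist (X (r j) \<omega>) (Y \<omega>) > (1/2)^j} \<le> (1/2)^j" for j
      using m[OF r] by (rule less_imp_le)
  qed
qed

text \<open>The counterpart without a given limit: consecutive distances are almost surely dominated
  by a geometric series from some index on, so the paths are Cauchy and completeness produces
  \<open>V\<close>.\<close>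

lemma AE_convergent_of_geometric:
  fixes X :: "nat \<Rightarrow> 'a \<Rightarrow> 'b::{real_normed_vector,complete_space,second_countable_topology}"
  assumes [measurable]: "\<And>k. X k \<in> borel_measurable M"
    and small: "\<And>k. prob {\<omega>\<in>space M. dist (X k \<omega>) (X (Suc k) \<omega>) > B * (1/2)^k} \<le> C * (1/2)^k"
  obtains V where "V \<in> borel_measurable M" "AE \<omega> in M. (\<lambda>k. X k \<omega>) \<longlonglongrightarrow> V \<omega>"
proof -
  let ?A = "\<lambda>k. {\<omega>\<in>space M. dist (X k \<omega>) (X (Suc k) \<omega>) > B * (1/2)^k}"
  have "summable (\<lambda>k. prob (?A k))"
    by (rule summable_comparison_test'[OF summable_mult[OF summable_geometric[of "1/2::real"], of C], where N=0])
       (use small in auto)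
  then have "AE \<omega> in M. eventually (\<lambda>k. \<omega> \<in> space M - ?A k) sequentially"
    by (intro borel_cantelli_AE1) (auto simp: emeasure_eq_measure)
  then have "AE \<omega> in M. (\<lambda>k. X k \<omega>) \<longlonglongrightarrow> lim (\<lambda>k. X k \<omega>)"
  proof eventually_elim
    case (elim \<omega>)
    then obtain K where K: "\<And>k. k \<ge> K \<Longrightarrow> dist (X k \<omega>) (X (Suc k) \<omega>) \<le> B * (1/2)^k"
      by (auto simp: eventually_sequentially not_less)
    \<comment> \<open>The bound is the exact sum of the geometric terms with indices from
      \<open>k\<close> to \<open>k + j - 1\<close>, a form that the induction reproduces.\<close>
    have tail: "dist (X k \<omega>) (X (k + j) \<omega>) \<le> 2 * B * (1/2)^k * (1 - (1/2)^j)" if "k \<ge> K" for k j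
    proof (induction j)
      case (Suc j)
      have "dist (X k \<omega>) (X (k + Suc j) \<omega>) \<le> 2 * B * (1/2)^k * (1 - (1/2)^j) + B * (1/2)^(k + j)"
        using dist_triangle[of "X k \<omega>" "X (k + Suc j) \<omega>" "X (k + j) \<omega>"] Suc K[of "k + j"] that by simp
      also have "\<dots> = 2 * B * (1/2)^k * (1 - (1/2)^Suc j)" by (simp add: power_add field_simps)
      finally show ?case .
    qed simp
    have B: "0 \<le> B * (1/2)^K" using K[of K] zero_le_dist order_trans by blast
    then have B: "0 \<le> B" by (auto simp: zero_le_mult_iff power_le_zero_eq)
    have "Cauchy (\<lambda>k. X k \<omega>)"
    proof (rule metric_CauchyI)
      fix e :: real assume e: "e > 0"
      have "(\<lambda>k. 4 * B * (1/2::real)^k) \<longlonglongrightarrow> 4 * B * 0"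
        by (intro tendsto_intros LIMSEQ_power_zero) simp
      then have "eventually (\<lambda>k. 4 * B * (1/2)^k < e) sequentially"
        using e by (intro order_tendstoD) auto
      then obtain N where N: "4 * B * (1/2)^(max N K) < e"
        unfolding eventually_sequentially by (meson max.cobounded1)
      define k where "k = max N K"
      have near: "dist (X k \<omega>) (X i \<omega>) \<le> 2 * B * (1/2)^k" if "i \<ge> k" for i
      proof -
        have "dist (X k \<omega>) (X (k + (i - k)) \<omega>) \<le> 2 * B * (1/2)^k * (1 - (1/2)^(i - k))"
          by (rule tail) (simp add: k_def)
        also have "\<dots> \<le> 2 * B * (1/2)^k * 1" using B by (intro mult_left_mono) auto
        finally show ?thesis using that by simp
      qed
      show "\<exists>N. \<forall>i\<ge>N. \<forall>j\<ge>N. dist (X i \<omega>) (X j \<omega>) < e"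
      proof (intro exI[of _ k] allI impI)
        fix i j assume "i \<ge> k" "j \<ge> k"
        then show "dist (X i \<omega>) (X j \<omega>) < e"
          using near[of i] near[of j] N dist_triangle3[of "X i \<omega>" "X j \<omega>" "X k \<omega>"]
          by (simp add: k_def)
      qed
    qed
    then show ?case by (simp add: Cauchy_convergent_iff convergent_LIMSEQ_iff)
  qed
  then obtain N where N: "{\<omega>\<in>space M. \<not> (\<lambda>k. X k \<omega>) \<longlonglongrightarrow> lim (\<lambda>k. X k \<omega>)} \<subseteq> N"
    and N_null: "emeasure M N = 0" and [measurable]: "N \<in> sets M"
    by (rule AE_E)
  \<comment> \<open>Setting the limit to 0 on a measurable null set turns almost sure convergence
    into convergence at every point, from which measurability of \<open>V\<close> follows.\<close>
  define V where "V \<omega> = indicat_real (- N) \<omega> *\<^sub>R lim (\<lambda>k. X k \<omega>)" for \<omega>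
  have lim: "(\<lambda>k. indicat_real (- N) \<omega> *\<^sub>R X k \<omega>) \<longlonglongrightarrow> V \<omega>" if "\<omega> \<in> space M" for \<omega>
  proof (cases "\<omega> \<in> N")
    case False
    then have "(\<lambda>k. X k \<omega>) \<longlonglongrightarrow> lim (\<lambda>k. X k \<omega>)" using N that by blast
    then show ?thesis using False by (simp add: V_def)
  qed (simp add: V_def)
  have "V \<in> borel_measurable M"
    by (rule borel_measurable_LIMSEQ_metric[OF _ lim]) measurable
  moreover have "AE \<omega> in M. \<omega> \<notin> N"
    using N_null by (intro AE_not_in) (auto simp: null_sets_def)
  then have "AE \<omega> in M. (\<lambda>k. X k \<omega>) \<longlonglongrightarrow> V \<omega>"
    using AE_space
  proof eventually_elim
    case (elim \<omega>)
    then show ?case using lim[of \<omega>] by simp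
  qed
  ultimately show thesis using that by blast
qed

end

section \<open>Riemann sums of a Levy process\<close>

lemma block_subset:
  fixes i q N :: nat
  assumes "J \<subseteq> {..<q}" "i < N"
  shows "(+) (i * q) ` J \<subseteq> {..<N * q}"
proof safe
  fix j assume "j \<in> J"
  then have "i * q + j < Suc i * q" using assms by auto
  also have "\<dots> \<le> N * q" using assms by (intro mult_right_mono) auto
  finally show "i * q + j < N * q" .
qed

locale levy_process_space = prob_space P
  for P :: "'w measure" +
  fixes Z :: "real \<Rightarrow> 'w \<Rightarrow> 'h::{real_inner,complete_space,second_countable_topology}"
  assumes levy: "levy_process P Z"
begin

lemma Z_measurable: "0 \<le> s \<Longrightarrow> Z s \<in> borel_measurable P"
  using levy by (auto simp: levy_process_def)

lemma Z_zero: "\<omega> \<in> space P \<Longrightarrow> Z 0 \<omega> = 0"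
  using levy by (auto simp: levy_process_def)

definition increment :: "real \<Rightarrow> nat \<Rightarrow> 'w \<Rightarrow> 'h" where
  "increment \<delta> m \<omega> = Z (real (Suc m) * \<delta>) \<omega> - Z (real m * \<delta>) \<omega>"

text \<open>The operators depend on the index and not on time. Changing \<open>\<delta>\<close> with
  \<open>T\<close> fixed therefore amounts to running the process at another speed, and this is how
  \<open>Z(s/n)\<close> enters.\<close>

definition riemann_sum :: "nat \<Rightarrow> real \<Rightarrow> (nat \<Rightarrow> 'h \<Rightarrow> 'h) \<Rightarrow> 'w \<Rightarrow> 'h" where
  "riemann_sum N \<delta> T \<omega> = (\<Sum>i<N. T i (increment \<delta> i \<omega>))"

lemma increment_measurable: "0 \<le> \<delta> \<Longrightarrow> increment \<delta> m \<in> borel_measurable P"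
  unfolding increment_def by (intro borel_measurable_diff Z_measurable) auto

lemma indep_increments:
  assumes "0 < \<delta>"
  shows "indep_vars (\<lambda>_. borel) (increment \<delta>) {..<N}"
proof -
  have "\<forall>n (ts::nat \<Rightarrow> real). 0 \<le> ts 0 \<and> (\<forall>i<n. ts i < ts (Suc i)) \<longrightarrow>
      indep_vars (\<lambda>_. borel) (\<lambda>i \<omega>. Z (ts (Suc i)) \<omega> - Z (ts i) \<omega>) {..<n}"
    using levy by (simp add: levy_process_def)
  from this[rule_format, of "\<lambda>i. real i * \<delta>" N] assms show ?thesis
    by (simp add: increment_def[abs_def])
qed

lemma distr_increment:
  assumes "0 \<le> \<delta>"
  shows "distr P borel (increment \<delta> m) = distr P borel (Z \<delta>)"
proof -
  have "\<forall>s\<ge>0. \<forall>t\<ge>0. distr P borel (\<lambda>\<omega>. Z (s + t) \<omega> - Z s \<omega>) = distr P borel (Z t)"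
    using levy by (simp add: levy_process_def)
  from this[rule_format, of "real m * \<delta>" \<delta>] assms show ?thesis
    by (simp add: increment_def[abs_def] algebra_simps)
qed

lemma increment_refine:
  "increment (real n * \<delta>) i \<omega> = (\<Sum>j<n. increment \<delta> (i * n + j) \<omega>)"
  using sum_lessThan_telescope[of "\<lambda>j. Z (real (i * n + j) * \<delta>) \<omega>" n]
  by (simp add: increment_def algebra_simps)

text \<open>The offsets \<open>J\<close> may have gaps, as they do when one copy is left out of a
  block. Only their number matters, and for an initial segment the sum telescopes.\<close>

lemma distr_increment_block:
  assumes \<delta>: "0 < \<delta>" and J: "finite J"
  shows "distr P borel (\<lambda>\<omega>. \<Sum>j\<in>J. increment \<delta> (m + j) \<omega>) = distr P borel (Z (real (card J) * \<delta>))"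
proof -
  have pow: "distr P borel (\<lambda>\<omega>. \<Sum>i\<in>I. increment \<delta> i \<omega>) = mconv_pow (distr P borel (Z \<delta>)) (card I)"
    if fin: "finite I" for I
  proof (rule distr_sum_indep_identical[OF fin])
    obtain b where "I \<subseteq> {..<b}" using fin by (auto simp: finite_nat_iff_bounded)
    then show "indep_vars (\<lambda>_. borel) (increment \<delta>) I"
      using indep_vars_subset[OF indep_increments[OF \<delta>]] by blast
  qed (use \<delta> in \<open>simp add: distr_increment\<close>)
  have "distr P borel (Z (real (card J) * \<delta>)) = distr P borel (\<lambda>\<omega>. \<Sum>i<card J. increment \<delta> i \<omega>)"
  proof (intro distr_cong refl)
    fix \<omega> assume "\<omega> \<in> space P"
    then show "Z (real (card J) * \<delta>) \<omega> = (\<Sum>i<card J. increment \<delta> i \<omega>)"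
      using increment_refine[of "card J" \<delta> 0 \<omega>]
      by (simp add: increment_def[of "real (card J) * \<delta>" 0] Z_zero)
  qed
  also have "\<dots> = distr P borel (\<lambda>\<omega>. \<Sum>i\<in>(+) m ` J. increment \<delta> i \<omega>)"
    using J by (simp add: pow card_image)
  finally show ?thesis by (simp add: sum.reindex)
qed

text \<open>From each block of \<open>q\<close> fine increments only the offsets in \<open>J\<close>
  are kept. The blocks stay independent, and each has the law of one increment of step
  \<open>card J * \<delta>\<close>. A singleton \<open>J\<close> gives one slow copy; a larger
  \<open>J\<close> gives the sum of \<open>card J\<close> copies.\<close>

lemma distr_riemann_sum_block:
  assumes \<delta>: "0 < \<delta>" and J: "J \<subseteq> {..<q}" "J \<noteq> {}"
    and T: "\<And>i. i < N \<Longrightarrow> T i \<in> borel_measurable borel"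
  shows "distr P borel (\<lambda>\<omega>. \<Sum>i<N. T i (\<Sum>j\<in>J. increment \<delta> (i * q + j) \<omega>)) =
    distr P borel (riemann_sum N (real (card J) * \<delta>) T)"
  unfolding riemann_sum_def[abs_def]
proof (rule distr_sum_indep_cong[where T=T and E="increment (real (card J) * \<delta>)"
      and D="\<lambda>i \<omega>. \<Sum>j\<in>J. increment \<delta> (i * q + j) \<omega>"])
  have fin: "finite J" using J finite_subset by blast
  then have c: "0 < real (card J) * \<delta>" using J \<delta> by (simp add: card_gt_0_iff)
  then show "indep_vars (\<lambda>_. borel) (increment (real (card J) * \<delta>)) {..<N}" by (rule indep_increments)
  have "indep_vars (\<lambda>_. borel) (\<lambda>i \<omega>. \<Sum>k\<in>(+) (i * q) ` J. increment \<delta> k \<omega>) {..<N}"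
  proof (rule indep_vars_block_sums[OF indep_increments[OF \<delta>]])
    show "(+) (i * q) ` J \<subseteq> {..<N * q}" if "i \<in> {..<N}" for i
      using that J by (intro block_subset) auto
    show "disjoint_family_on (\<lambda>i. (+) (i * q) ` J) {..<N}"
    proof (unfold disjoint_family_on_def, safe)
      fix i i' j j' assume "i \<noteq> i'" "j \<in> J" "j' \<in> J" "i * q + j = i' * q + j'"
      moreover have "(i * q + j) div q = i" "(i' * q + j') div q = i'"
        using J \<open>j \<in> J\<close> \<open>j' \<in> J\<close> by auto
      ultimately show "i * q + j \<in> {}" by metis
    qed
  qed
  then show "indep_vars (\<lambda>_. borel) (\<lambda>i \<omega>. \<Sum>j\<in>J. increment \<delta> (i * q + j) \<omega>) {..<N}"
    by (simp add: sum.reindex)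
  show "distr P borel (\<lambda>\<omega>. \<Sum>j\<in>J. increment \<delta> (i * q + j) \<omega>) =
      distr P borel (increment (real (card J) * \<delta>) i)" for i
    using c by (simp add: distr_increment distr_increment_block[OF \<delta> fin])
qed (use T in auto)

lemma riemann_sum_measurable:
  assumes "0 \<le> \<delta>" "\<And>i. i < N \<Longrightarrow> T i \<in> borel_measurable borel"
  shows "riemann_sum N \<delta> T \<in> borel_measurable P"
  unfolding riemann_sum_def[abs_def]
  by (intro borel_measurable_sum measurable_compose[OF increment_measurable assms(2)]) (use assms in auto)

text \<open>Each increment of step \<open>n * \<delta>\<close> splits into \<open>n\<close> pieces,
  and \<open>U j\<close> collects the \<open>j\<close>-th piece of every one of them. Different
  \<open>j\<close> use different residue classes modulo \<open>n\<close>, so the \<open>U j\<close>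
  are independent; linearity of the operators reassembles the full sum.\<close>

lemma distr_riemann_sum_pow:
  assumes \<delta>: "0 < \<delta>" and n: "n \<ge> 1" and T: "\<And>i. i < N \<Longrightarrow> bounded_linear (T i)"
  shows "distr P borel (riemann_sum N (real n * \<delta>) T) = mconv_pow (distr P borel (riemann_sum N \<delta> T)) n"
proof -
  have Tm: "T i \<in> borel_measurable borel" if "i < N" for i
    using borel_measurable_continuous_onI[OF linear_continuous_on[OF T[OF that]]] .
  define U where "U j \<omega> = (\<Sum>i<N. T i (increment \<delta> (i * n + j) \<omega>))" for j \<omega>
  have "distr P borel (U j) = distr P borel (riemann_sum N \<delta> T)" if "j < n" for j
    using distr_riemann_sum_block[OF \<delta>, of "{j}" n N T] that Tm by (simp add: U_def[abs_def])
  moreover have "indep_vars (\<lambda>_. borel) U {..<n}"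
  proof -
    have inj: "inj_on (\<lambda>i. i * n + j) {..<N}" for j using n by (auto simp: inj_on_def)
    have "indep_vars (\<lambda>_. borel) (\<lambda>k \<omega>. T (k div n) (increment \<delta> k \<omega>)) {..<N * n}"
      using n by (intro indep_vars_compose2[OF indep_increments[OF \<delta>]] Tm)
        (auto simp: less_mult_imp_div_less)
    then have "indep_vars (\<lambda>_. borel)
        (\<lambda>j \<omega>. \<Sum>k\<in>(\<lambda>i. i * n + j) ` {..<N}. T (k div n) (increment \<delta> k \<omega>)) {..<n}"
    proof (rule indep_vars_block_sums)
      show "(\<lambda>i. i * n + j) ` {..<N} \<subseteq> {..<N * n}" if "j \<in> {..<n}" for j
        using block_subset[of "{j}" n] that by auto
      show "disjoint_family_on (\<lambda>j. (\<lambda>i. i * n + j) ` {..<N}) {..<n}"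
      proof (unfold disjoint_family_on_def, safe)
        fix i i' j j' assume "j \<noteq> j'" "j < n" "j' < n" "i * n + j = i' * n + j'"
        moreover have "(i * n + j) mod n = j" "(i' * n + j') mod n = j'"
          using \<open>j < n\<close> \<open>j' < n\<close> by auto
        ultimately show "i * n + j \<in> {}" by metis
      qed
    qed
    then have "indep_vars (\<lambda>_. borel)
        (\<lambda>j \<omega>. \<Sum>i<N. T ((i * n + j) div n) (increment \<delta> (i * n + j) \<omega>)) {..<n}"
      by (simp add: sum.reindex[OF inj])
    then show ?thesis
      by (rule iffD1[OF indep_vars_cong, rotated -1]) (auto simp: U_def fun_eq_iff)
  qed
  ultimately have "distr P borel (\<lambda>\<omega>. \<Sum>j<n. U j \<omega>) = mconv_pow (distr P borel (riemann_sum N \<delta> T)) n"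
    using distr_sum_indep_identical[of "{..<n}" U] by simp
  moreover have "(\<Sum>j<n. U j \<omega>) = riemann_sum N (real n * \<delta>) T \<omega>" for \<omega>
  proof -
    have "(\<Sum>j<n. U j \<omega>) = (\<Sum>i<N. \<Sum>j<n. T i (increment \<delta> (i * n + j) \<omega>))"
      unfolding U_def by (rule sum.swap)
    also have "\<dots> = riemann_sum N (real n * \<delta>) T \<omega>"
      unfolding riemann_sum_def increment_refine
      by (intro sum.cong refl linear_sum[symmetric] bounded_linear.linear[OF T]) simp
    finally show ?thesis .
  qed
  ultimately show ?thesis by simp
qed

lemma prob_norm_distr:
  assumes "X \<in> borel_measurable P"
  shows "prob {\<omega>\<in>space P. norm (X \<omega> :: 'h) > e} = measure (distr P borel X) {x. norm x > e}"
  using assms by (subst measure_distr) (auto intro!: arg_cong[where f=prob])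

text \<open>If a sum of \<open>n\<close> independent copies of \<open>X\<close> is small with high probability, then so is \<open>X\<close>:
  take \<open>n + 1\<close> copies and let \<open>A j\<close> be the sum of all but the \<open>j\<close>-th one;
  then \<open>n X 0 = (\<Sum>j\<le>n. A j) - n A 0\<close>.\<close>
lemma prob_riemann_sum_root:
  assumes \<delta>: "0 < \<delta>" and n: "n \<ge> 1" and T: "\<And>i. i < N \<Longrightarrow> bounded_linear (T i)" and e: "0 \<le> e"
  shows "prob {\<omega>\<in>space P. norm (riemann_sum N \<delta> T \<omega>) > 2 * e}
    \<le> (real n + 1) * prob {\<omega>\<in>space P. norm (riemann_sum N (real n * \<delta>) T \<omega>) > e}"
proof -
  have Tm: "T i \<in> borel_measurable borel" if "i < N" for i
    using borel_measurable_continuous_onI[OF linear_continuous_on[OF T[OF that]]] .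
  \<comment> \<open>Blocks of length \<open>Suc n\<close> provide the \<open>n + 1\<close> copies
    \<open>S {j}\<close>; leaving one out keeps \<open>n\<close> of them, which matches the law on
    the right-hand side.\<close>
  define S where "S J \<omega> = (\<Sum>i<N. T i (\<Sum>j\<in>J. increment \<delta> (i * Suc n + j) \<omega>))" for J \<omega>
  define A where "A j = S ({..n} - {j})" for j
  have S_law: "distr P borel (S J) = distr P borel (riemann_sum N (real (card J) * \<delta>) T)"
    if "J \<subseteq> {..n}" "J \<noteq> {}" for J
    unfolding S_def[abs_def] using that
    by (intro distr_riemann_sum_block[OF \<delta>] Tm) (auto simp: lessThan_Suc_atMost)
  have S_meas [measurable]: "S J \<in> borel_measurable P" for J
    unfolding S_def[abs_def] using \<delta>
    by (intro borel_measurable_sum measurable_compose[OF _ Tm] increment_measurable) auto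
  have S_add: "S J \<omega> = (\<Sum>j\<in>J. S {j} \<omega>)" for J \<omega>
    unfolding S_def by (subst sum.swap)
      (auto intro!: sum.cong linear_sum bounded_linear.linear[OF T])
  have rs_meas: "riemann_sum N d T \<in> borel_measurable P" if "0 \<le> d" for d
    using that Tm by (rule riemann_sum_measurable)
  define p where "p = prob {\<omega>\<in>space P. norm (riemann_sum N (real n * \<delta>) T \<omega>) > e}"
  have A_prob: "prob {\<omega>\<in>space P. norm (A j \<omega>) > e} = p" if "j \<le> n" for j
  proof -
    have "{..n} - {j} \<noteq> {}" using n that by (metis One_nat_def atMost_iff empty_iff insert_Diff
          le_zero_eq not_one_le_zero singleton_iff zero_le)
    then have "distr P borel (A j) = distr P borel (riemann_sum N (real n * \<delta>) T)"
      using S_law[of "{..n} - {j}"] that by (simp add: A_def card_Diff_singleton)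
    then show ?thesis unfolding p_def
      by (subst (1 2) prob_norm_distr) (use \<delta> in \<open>auto simp: A_def intro!: rs_meas\<close>)
  qed
  have "prob {\<omega>\<in>space P. norm (riemann_sum N \<delta> T \<omega>) > 2 * e} = prob {\<omega>\<in>space P. norm (S {0} \<omega>) > 2 * e}"
    using S_law[of "{0}"] by (subst (1 2) prob_norm_distr) (use \<delta> in \<open>auto intro!: rs_meas\<close>)
  also have "\<dots> \<le> prob (\<Union>j\<in>{..n}. {\<omega>\<in>space P. norm (A j \<omega>) > e})"
  proof (rule finite_measure_mono)
    show "{\<omega>\<in>space P. norm (S {0} \<omega>) > 2 * e} \<subseteq> (\<Union>j\<in>{..n}. {\<omega>\<in>space P. norm (A j \<omega>) > e})"
    proof (rule subsetI, rule ccontr)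
      fix \<omega> assume "\<omega> \<in> {\<omega>\<in>space P. norm (S {0} \<omega>) > 2 * e}"
        and "\<omega> \<notin> (\<Union>j\<in>{..n}. {\<omega>\<in>space P. norm (A j \<omega>) > e})"
      then have \<omega>: "norm (S {0} \<omega>) > 2 * e" "\<And>j. j \<le> n \<Longrightarrow> norm (A j \<omega>) \<le> e"
        by (auto simp: not_less)
      have A_eq: "A j \<omega> = S {..n} \<omega> - S {j} \<omega>" if "j \<le> n" for j
        using that by (simp add: A_def S_add[of "{..n} - {j}"] S_add[of "{..n}"] sum_diff1)
      have "(\<Sum>j\<le>n. A j \<omega>) = real (Suc n) *\<^sub>R S {..n} \<omega> - S {..n} \<omega>"
        using S_add[of "{..n}" \<omega>] by (simp add: A_eq sum_subtractf sum_constant_scaleR)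
      moreover have "S {0} \<omega> = S {..n} \<omega> - A 0 \<omega>" by (simp add: A_eq)
      ultimately have "real n *\<^sub>R S {0} \<omega> = (\<Sum>j\<le>n. A j \<omega>) - real n *\<^sub>R A 0 \<omega>"
        by (simp add: scaleR_diff_right scaleR_left_distrib)
      \<comment> \<open>Taking the term \<open>j = 0\<close> out of the sum lowers the coefficient
        of \<open>A 0\<close> to \<open>n - 1\<close>, which leaves \<open>2 * n - 1\<close> vectors
        of norm at most \<open>e\<close>. The factor \<open>n + 1\<close> of the statement is the
        union bound over the \<open>A j\<close>.\<close>
      also have "(\<Sum>j\<le>n. A j \<omega>) = A 0 \<omega> + (\<Sum>j\<in>{1..n}. A j \<omega>)"
        by (simp add: sum.atMost_shift sum.atLeast1_atMost_eq)
      finally have "real n *\<^sub>R S {0} \<omega> = (\<Sum>j\<in>{1..n}. A j \<omega>) - (real n - 1) *\<^sub>R A 0 \<omega>"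
        by (simp add: algebra_simps)
      then have "real n * norm (S {0} \<omega>) \<le> norm (\<Sum>j\<in>{1..n}. A j \<omega>) + norm ((real n - 1) *\<^sub>R A 0 \<omega>)"
        using norm_triangle_ineq4 by (metis abs_of_nat norm_scaleR)
      also have "\<dots> \<le> real n * e + (real n - 1) * e"
      proof (rule add_mono)
        show "norm (\<Sum>j\<in>{1..n}. A j \<omega>) \<le> real n * e"
          using sum_norm_le[of "{1..n}" "\<lambda>j. A j \<omega>" "\<lambda>_. e"] \<omega>(2) by simp
        show "norm ((real n - 1) *\<^sub>R A 0 \<omega>) \<le> (real n - 1) * e"
          using n \<omega>(2)[of 0] by (simp add: mult_left_mono)
      qed
      also have "\<dots> \<le> real n * (2 * e)" using e by (simp add: algebra_simps)
      finally have "norm (S {0} \<omega>) \<le> 2 * e" using n by simp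
      then show False using \<omega>(1) by simp
    qed
  qed (auto simp: A_def intro!: sets.finite_UN)
  also have "\<dots> \<le> (\<Sum>j\<in>{..n}. prob {\<omega>\<in>space P. norm (A j \<omega>) > e})"
    by (rule finite_measure_subadditive_finite) (auto simp: A_def)
  also have "\<dots> = (real n + 1) * p" by (simp add: A_prob)
  finally show ?thesis by (simp add: p_def)
qed

text \<open>A coarse sum is a fine sum whose operators are constant on blocks. Sums on two nested
  grids thereby become sums over the same increments and can be subtracted termwise.\<close>

lemma riemann_sum_refine:
  assumes T: "\<And>i. i < N \<Longrightarrow> bounded_linear (T i)" and r: "r \<ge> 1"
  shows "riemann_sum N (real r * \<delta>) T = riemann_sum (N * r) \<delta> (\<lambda>i. T (i div r))"
proof
  fix \<omega>
  have "riemann_sum N (real r * \<delta>) T \<omega> = (\<Sum>i<N. \<Sum>j<r. T i (increment \<delta> (i * r + j) \<omega>))"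
    unfolding riemann_sum_def increment_refine
    by (intro sum.cong refl linear_sum bounded_linear.linear[OF T]) simp
  also have "\<dots> = (\<Sum>i<N. \<Sum>k\<in>{i*r..<i*r+r}. T (k div r) (increment \<delta> k \<omega>))"
  proof (rule sum.cong[OF refl])
    fix i
    have "(\<Sum>k\<in>{i*r..<i*r+r}. T (k div r) (increment \<delta> k \<omega>)) =
        (\<Sum>j<r. T ((j + i * r) div r) (increment \<delta> (j + i * r) \<omega>))"
      using sum.shift_bounds_nat_ivl[of "\<lambda>k. T (k div r) (increment \<delta> k \<omega>)" 0 "i * r" r]
      by (simp add: atLeast0LessThan add.commute)
    then show "(\<Sum>j<r. T i (increment \<delta> (i * r + j) \<omega>)) =
        (\<Sum>k\<in>{i*r..<i*r+r}. T (k div r) (increment \<delta> k \<omega>))"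
      by (simp add: add.commute)
  qed
  also have "\<dots> = riemann_sum (N * r) \<delta> (\<lambda>i. T (i div r)) \<omega>"
    unfolding riemann_sum_def by (rule sum.nat_group)
  finally show "riemann_sum N (real r * \<delta>) T \<omega> = riemann_sum (N * r) \<delta> (\<lambda>i. T (i div r)) \<omega>" .
qed

text \<open>The \<open>n\<close>-th root of the law of \<open>Y\<close> is the law of an almost sure
  limit of slow Riemann sums. All the work lies in showing that these converge, because
  \<open>conv\<close> speaks of the original speed only.\<close>

lemma infinitely_divisible_limit:
  fixes F :: "real \<Rightarrow> 'h \<Rightarrow> 'h"
  assumes t: "0 < t" and F: "\<And>s. s \<in> {0..t} \<Longrightarrow> bounded_linear (F s)"
    and [measurable]: "Y \<in> borel_measurable P"
    and conv: "\<And>e. e > 0 \<Longrightarrow> \<exists>m. \<forall>k\<ge>m. prob {\<omega>\<in>space P.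
      dist (riemann_sum (2^k) (t / 2^k) (\<lambda>i. F (real i * (t / 2^k))) \<omega>) (Y \<omega>) > e} < e"
  shows "infinitely_divisible P Y"
  unfolding infinitely_divisible_def
proof (intro allI impI)
  fix n :: nat assume n: "n \<ge> 1"
  define T where "T k i = F (real i * (t / 2^k))" for k i :: nat
  define S where "S k = riemann_sum (2^k) (t / 2^k) (T k)" for k :: nat
  \<comment> \<open>Same operators as in \<open>S\<close>, step divided by \<open>n\<close>: the
    Riemann sum that belongs to the process s -> Z(s/n).\<close>
  define S' where "S' k = riemann_sum (2^k) (t / 2^k / real n) (T k)" for k :: nat
  have T: "bounded_linear (T k i)" if "i < 2^k" for k i
    unfolding T_def
  proof (rule F)
    have "real i \<le> 2^k" using that by (metis of_nat_le_iff of_nat_numeral of_nat_power less_imp_le)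
    then have "real i * t \<le> 2^k * t" using t by (intro mult_right_mono) auto
    then show "real i * (t / 2^k) \<in> {0..t}" using t by (simp add: field_simps)
  qed
  have Tm: "T k i \<in> borel_measurable borel" if "i < 2^k" for k i
    using borel_measurable_continuous_onI[OF linear_continuous_on[OF T[OF that]]] .
  have [measurable]: "S k \<in> borel_measurable P" "S' k \<in> borel_measurable P" for k
    unfolding S_def S'_def using t by (auto intro!: riemann_sum_measurable Tm)
  have "\<exists>m. \<forall>k\<ge>m. prob {\<omega>\<in>space P. dist (S k \<omega>) (Y \<omega>) > e} < e" if "e > 0" for e
    using conv[OF that] unfolding S_def T_def .
  then obtain r where r: "strict_mono r"
    and S_small: "\<And>j. prob {\<omega>\<in>space P. dist (S (r j) \<omega>) (Y \<omega>) > (1/2)^j} \<le> (1/2)^j"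
    by (rule geometric_subsequence) (assumption, rule that, assumption+)
  have r_Suc: "r j \<le> r (Suc j)" for j using r by (simp add: strict_mono_less_eq)
  have S_lim: "AE \<omega> in P. (\<lambda>j. S (r j) \<omega>) \<longlonglongrightarrow> Y \<omega>"
    using S_small by (intro AE_tendsto_of_geometric) auto
  have root: "prob {\<omega>\<in>space P. dist (S' k \<omega>) (S' l \<omega>) > 2 * e}
      \<le> (real n + 1) * prob {\<omega>\<in>space P. dist (S k \<omega>) (S l \<omega>) > e}" if "k \<le> l" "0 \<le> e" for k l e
  proof -
    define q :: nat where "q = 2^(l - k)"
    have q: "q \<ge> 1" "2^l = 2^k * q" by (simp_all add: q_def power_add[symmetric] that)
    have ql: "(2::real)^l = 2^k * real q" using q(2) by (metis of_nat_mult of_nat_numeral of_nat_power)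
    \<comment> \<open>Operators of the difference of levels \<open>k\<close> and \<open>l\<close>,
      both written on the finer grid. The identity \<open>diff\<close> holds for every speed
      \<open>c\<close>; the speeds \<open>n\<close> and 1 give the slow and the original
      difference.\<close>
    define W where "W i x = T k (i div q) x - T l i x" for i x
    have W: "bounded_linear (W i)" if "i < 2^l" for i
      unfolding W_def[abs_def] using that q
      by (intro bounded_linear_sub T) (auto simp: less_mult_imp_div_less)
    have diff: "riemann_sum (2^k) (t / 2^k / c) (T k) \<omega> - riemann_sum (2^l) (t / 2^l / c) (T l) \<omega>
        = riemann_sum (2^l) (t / 2^l / c) W \<omega>" for c \<omega>
    proof -
      have "t / 2^k / c = real q * (t / 2^l / c)" using q(1) by (simp add: ql)
      then have "riemann_sum (2^k) (t / 2^k / c) (T k) = riemann_sum (2^l) (t / 2^l / c) (\<lambda>i. T k (i div q))"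
        using riemann_sum_refine[of "2^k" "T k" q, OF T q(1)] q(2) by metis
      then show ?thesis by (simp add: riemann_sum_def W_def sum_subtractf)
    qed
    have "prob {\<omega>\<in>space P. norm (riemann_sum (2^l) (t / 2^l / real n) W \<omega>) > 2 * e}
        \<le> (real n + 1) * prob {\<omega>\<in>space P. norm (riemann_sum (2^l) (real n * (t / 2^l / real n)) W \<omega>) > e}"
      using t n that by (intro prob_riemann_sum_root W) auto
    then show ?thesis
      using n diff[of "real n"] diff[of 1] by (simp add: dist_norm S_def S'_def)
  qed
  \<comment> \<open>The triangle inequality through \<open>Y\<close> bounds the original sums with
    threshold and probability both \<open>2 * (1/2)^j\<close>. By \<open>root\<close> the threshold
    doubles and the probability gains the factor \<open>n + 1\<close>.\<close>
  have "prob {\<omega>\<in>space P. dist (S' (r j) \<omega>) (S' (r (Suc j)) \<omega>) > 4 * (1/2)^j}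
      \<le> 2 * (real n + 1) * (1/2)^j" for j
  proof -
    have "prob {\<omega>\<in>space P. dist (S (r j) \<omega>) (S (r (Suc j)) \<omega>) > 2 * (1/2)^j}
        \<le> prob ({\<omega>\<in>space P. dist (S (r j) \<omega>) (Y \<omega>) > (1/2)^j} \<union>
            {\<omega>\<in>space P. dist (S (r (Suc j)) \<omega>) (Y \<omega>) > (1/2)^Suc j})"
    proof (rule finite_measure_mono)
      show "{\<omega>\<in>space P. dist (S (r j) \<omega>) (S (r (Suc j)) \<omega>) > 2 * (1/2)^j} \<subseteq>
          {\<omega>\<in>space P. dist (S (r j) \<omega>) (Y \<omega>) > (1/2)^j} \<union>
            {\<omega>\<in>space P. dist (S (r (Suc j)) \<omega>) (Y \<omega>) > (1/2)^Suc j}"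
      proof safe
        fix \<omega> assume "2 * (1/2)^j < dist (S (r j) \<omega>) (S (r (Suc j)) \<omega>)"
          and "\<not> (1/2)^Suc j < dist (S (r (Suc j)) \<omega>) (Y \<omega>)"
        moreover have "(1/2)^Suc j \<le> (1/2::real)^j" by simp
        ultimately show "(1/2)^j < dist (S (r j) \<omega>) (Y \<omega>)"
          using dist_triangle2[of "S (r j) \<omega>" "S (r (Suc j)) \<omega>" "Y \<omega>"] by linarith
      qed
    qed measurable
    also have "\<dots> \<le> prob {\<omega>\<in>space P. dist (S (r j) \<omega>) (Y \<omega>) > (1/2)^j} +
        prob {\<omega>\<in>space P. dist (S (r (Suc j)) \<omega>) (Y \<omega>) > (1/2)^Suc j}"
      by (rule measure_Un_le) measurable
    also have "\<dots> \<le> (1/2)^j + (1/2)^Suc j" by (intro add_mono S_small)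
    also have "\<dots> \<le> 2 * (1/2)^j" by simp
    finally have "(real n + 1) * prob {\<omega>\<in>space P. dist (S (r j) \<omega>) (S (r (Suc j)) \<omega>) > 2 * (1/2)^j}
        \<le> (real n + 1) * (2 * (1/2)^j)" by (intro mult_left_mono) auto
    from order_trans[OF root[OF r_Suc] this] show ?thesis by (simp add: algebra_simps)
  qed
  then obtain V where [measurable]: "V \<in> borel_measurable P"
    and V: "AE \<omega> in P. (\<lambda>j. S' (r j) \<omega>) \<longlonglongrightarrow> V \<omega>"
    by (rule AE_convergent_of_geometric[rotated]) auto
  interpret Pi: product_prob_space "\<lambda>_. P" "{..<n}" ..
  \<comment> \<open>Along the subsequence, \<open>S (r j)\<close> on \<open>P\<close> and the sum of
    the coordinate copies of \<open>S' (r j)\<close> on the product have equal laws, and both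
    converge almost surely.\<close>
  have "distr P borel Y = distr (PiM {..<n} (\<lambda>_. P)) borel (\<lambda>\<omega>. \<Sum>j<n. V (\<omega> j))"
  proof (rule distr_eq_of_AE_limits[OF prob_space_axioms Pi.prob_space_axioms _ _ _ _ S_lim])
    have "AE \<omega> in PiM {..<n} (\<lambda>_. P). (\<lambda>j. S' (r j) (\<omega> i)) \<longlonglongrightarrow> V (\<omega> i)" if "i < n" for i
      using V that by (intro AE_PiM_component prob_space_axioms) auto
    then have "AE \<omega> in PiM {..<n} (\<lambda>_. P). \<forall>i\<in>{..<n}. (\<lambda>j. S' (r j) (\<omega> i)) \<longlonglongrightarrow> V (\<omega> i)"
      by (intro AE_finite_allI) auto
    then show "AE \<omega> in PiM {..<n} (\<lambda>_. P). (\<lambda>j. \<Sum>i<n. S' (r j) (\<omega> i)) \<longlonglongrightarrow> (\<Sum>i<n. V (\<omega> i))"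
      by eventually_elim (intro tendsto_sum, auto)
    have "distr P borel (S k) = mconv_pow (distr P borel (S' k)) n" for k
      unfolding S_def S'_def using t n
        distr_riemann_sum_pow[of "t / 2^k / real n" n "2^k" "T k", OF _ n T] by simp
    then show "distr P borel (S (r k)) = distr (PiM {..<n} (\<lambda>_. P)) borel (\<lambda>\<omega>. \<Sum>i<n. S' (r k) (\<omega> i))" for k
      by (simp add: mconv_pow_distr[OF _ n])
  qed measurable
  then have "distr P borel Y = mconv_pow (distr P borel V) n"
    by (simp add: mconv_pow_distr[OF _ n])
  then show "\<exists>\<mu>. prob_space \<mu> \<and> sets \<mu> = sets borel \<and> distr P borel Y = mconv_pow \<mu> n"
    by (intro exI[of _ "distr P borel V"]) (auto intro: prob_space_distr)
qed

end

section \<open>Levy kernels and Riemann integration\<close>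

text \<open>A type of sort \<open>{real_inner, complete_space}\<close> is not an instance of \<open>banach\<close>, so the general
  integrability criterion does not apply. The value of the integral is obtained from the Riesz
  representation of \<open>y \<mapsto> \<integral> \<langle>f, y\<rangle>\<close>.\<close>
lemma integrable_hilbert_bound:
  fixes f :: "'a \<Rightarrow> 'h::{real_inner,complete_space,second_countable_topology}"
  assumes [measurable]: "f \<in> borel_measurable M" and w: "integrable M w"
    and bound: "\<And>x. x \<in> space M \<Longrightarrow> norm (f x) \<le> w x"
  shows "integrable M f"
proof -
  have [measurable]: "w \<in> borel_measurable M" using w by auto
  have w0: "0 \<le> w x" if "x \<in> space M" for x
    using bound[OF that] norm_ge_zero[of "f x"] by linarith
  have inner_int: "integrable M (\<lambda>x. inner (f x) y)" for y
  proof (rule Bochner_Integration.integrable_bound)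
    show "integrable M (\<lambda>x. w x * norm y)" using w by simp
    show "AE x in M. norm (inner (f x) y) \<le> norm (w x * norm y)"
    proof (rule AE_I2)
      fix x assume x: "x \<in> space M"
      have "norm (inner (f x) y) \<le> norm (f x) * norm y"
        using Cauchy_Schwarz_ineq2[of "f x" y] by simp
      also have "\<dots> \<le> w x * norm y" using bound[OF x] by (intro mult_right_mono) auto
      finally show "norm (inner (f x) y) \<le> norm (w x * norm y)" by simp
    qed
  qed measurable
  have "bounded_linear (\<lambda>y. LINT x|M. inner (f x) y)"
  proof (rule bounded_linear_intro[where K="LINT x|M. w x"])
    fix y
    have "norm (LINT x|M. inner (f x) y) \<le> (LINT x|M. w x * norm y)"
    proof (rule Bochner_Integration.integral_norm_bound[THEN order_trans], rule integral_mono)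
      show "integrable M (\<lambda>x. norm (inner (f x) y))" using inner_int by simp
      show "integrable M (\<lambda>x. w x * norm y)" using w by simp
      fix x assume x: "x \<in> space M"
      have "norm (inner (f x) y) \<le> norm (f x) * norm y"
        using Cauchy_Schwarz_ineq2[of "f x" y] by simp
      also have "\<dots> \<le> w x * norm y" using bound[OF x] by (intro mult_right_mono) auto
      finally show "norm (inner (f x) y) \<le> w x * norm y" .
    qed
    then show "norm (LINT x|M. inner (f x) y) \<le> norm y * (LINT x|M. w x)" by (simp add: mult.commute)
  qed (simp_all add: inner_add_right inner_int)
  then obtain I where I: "\<And>y. (LINT x|M. inner (f x) y) = inner y I"
    using riesz_representation by blast
  obtain s where s: "\<And>i. simple_function M (s i)" "\<And>x. x \<in> space M \<Longrightarrow> (\<lambda>i. s i x) \<longlonglongrightarrow> f x"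
    "\<And>i x. x \<in> space M \<Longrightarrow> norm (s i x) \<le> 2 * norm (f x)"
    using borel_measurable_implies_sequence_metric[of f M 0] by (simp add: dist_norm) blast
  have [measurable]: "s i \<in> borel_measurable M" for i using s(1) by (rule borel_measurable_simple_function)
  have s_le: "norm (s i x) \<le> 2 * w x" if "x \<in> space M" for i x
    using s(3)[OF that, of i] bound[OF that] by linarith
  have w_fin: "(\<integral>\<^sup>+x. ennreal (2 * w x) \<partial>M) < \<infinity>"
  proof -
    have "(\<integral>\<^sup>+x. ennreal (2 * w x) \<partial>M) = ennreal (LINT x|M. 2 * w x)"
      using w w0 by (intro nn_integral_eq_integral) (auto intro!: AE_I2)
    then show ?thesis by simp
  qed
  have sb: "Bochner_Integration.simple_bochner_integrable M (s i)" for i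
  proof (rule simple_bochner_integrableI_bounded[OF s(1)])
    have "(\<integral>\<^sup>+x. norm (s i x) \<partial>M) \<le> (\<integral>\<^sup>+x. ennreal (2 * w x) \<partial>M)"
      by (intro nn_integral_mono ennreal_leI s_le)
    then show "(\<integral>\<^sup>+x. norm (s i x) \<partial>M) < \<infinity>" using w_fin by (rule le_less_trans)
  qed
  have lim: "(\<lambda>i. \<integral>\<^sup>+x. norm (f x - s i x) \<partial>M) \<longlonglongrightarrow> 0"
    by (rule nn_integral_dominated_convergence_norm[where w="\<lambda>x. 2 * w x"])
       (use s_le s(2) w_fin in auto)
  have diff_int: "integrable M (\<lambda>x. norm (f x - s i x))" for i
  proof (rule Bochner_Integration.integrable_bound[of _ "\<lambda>x. 3 * w x"])
    show "AE x in M. norm (norm (f x - s i x)) \<le> norm (3 * w x)"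
    proof (rule AE_I2)
      fix x assume "x \<in> space M"
      then show "norm (norm (f x - s i x)) \<le> norm (3 * w x)"
        using norm_triangle_ineq4[of "f x" "s i x"] s_le[of x i] bound[of x] w0[of x] by simp
    qed
  qed (use w in auto)
  \<comment> \<open>Duality estimate: testing the difference of the simple integral and
    \<open>I\<close> against itself reduces its norm to scalar integrals, and one factor of the norm
    cancels.\<close>
  have dist_le: "norm (Bochner_Integration.simple_bochner_integral M (s i) - I) \<le> (LINT x|M. norm (f x - s i x))" for i
  proof -
    let ?b = "Bochner_Integration.simple_bochner_integral M (s i)"
    let ?v = "?b - I"
    have sv: "has_bochner_integral M (\<lambda>x. inner (s i x) ?v) (inner ?b ?v)"
      by (intro has_bochner_integral_inner_left has_bochner_integral_simple_bochner_integrable sb)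
    have "norm ?v * norm ?v = (LINT x|M. inner (s i x) ?v) - (LINT x|M. inner (f x) ?v)"
      using has_bochner_integral_integral_eq[OF sv] I[of ?v]
      by (simp add: power2_norm_eq_inner inner_diff_left inner_commute flip: power2_eq_square)
    also have "\<dots> = (LINT x|M. inner (s i x) ?v - inner (f x) ?v)"
      using sv inner_int by (intro Bochner_Integration.integral_diff[symmetric]) (auto simp: has_bochner_integral_iff)
    also have "\<dots> \<le> (LINT x|M. norm (f x - s i x) * norm ?v)"
    proof (rule integral_mono)
      show "integrable M (\<lambda>x. inner (s i x) ?v - inner (f x) ?v)"
        using sv inner_int by (auto simp: has_bochner_integral_iff)
      show "integrable M (\<lambda>x. norm (f x - s i x) * norm ?v)" using diff_int by simp
      show "inner (s i x) ?v - inner (f x) ?v \<le> norm (f x - s i x) * norm ?v" for x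
        using norm_cauchy_schwarz[of "s i x - f x" ?v]
        by (simp add: inner_diff_left norm_minus_commute)
    qed
    also have "\<dots> = (LINT x|M. norm (f x - s i x)) * norm ?v" by simp
    finally show ?thesis
      by (cases "?v = 0") (auto simp: mult_le_cancel_right)
  qed
  have "(\<lambda>i. LINT x|M. norm (f x - s i x)) \<longlonglongrightarrow> 0"
  proof -
    have "(\<lambda>i. ennreal (LINT x|M. norm (f x - s i x))) \<longlonglongrightarrow> ennreal 0"
      using lim diff_int by (simp add: nn_integral_eq_integral)
    then show ?thesis by (subst (asm) tendsto_ennreal_iff) auto
  qed
  then have "(\<lambda>i. norm (Bochner_Integration.simple_bochner_integral M (s i) - I)) \<longlonglongrightarrow> 0"
    by (rule tendsto_sandwich[OF _ _ tendsto_const, rotated -1]) (use dist_le in auto)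
  then have "(\<lambda>i. Bochner_Integration.simple_bochner_integral M (s i)) \<longlonglongrightarrow> I"
    by (rule LIM_zero_cancel[OF tendsto_norm_zero_cancel])
  with sb lim have "has_bochner_integral M f I"
    by (intro has_bochner_integral.intros) auto
  then show ?thesis by (rule integrable.intros)
qed

definition levy_kernel :: "'h::real_inner \<Rightarrow> 'h \<Rightarrow> complex" where
  "levy_kernel y x = exp (\<i> * complex_of_real (inner y x)) - 1
    - \<i> * complex_of_real (inner y x) * complex_of_real (indicator {x. norm x < 1} x)"

definition levy_exponent :: "'h::real_inner \<Rightarrow> ('h \<Rightarrow> 'h) \<Rightarrow> 'h measure \<Rightarrow> 'h \<Rightarrow> complex" where
  "levy_exponent a \<Theta> M y = \<i> * complex_of_real (inner a y) - complex_of_real (inner (\<Theta> y) y / 2)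
    + (LINT x|M. levy_kernel y x)"

lemma levy_kernel_measurable [measurable]:
  fixes y :: "'h::{real_inner,second_countable_topology}"
  shows "levy_kernel y \<in> borel_measurable borel"
  unfolding levy_kernel_def[abs_def] by measurable

lemma levy_kernel_zero [simp]: "levy_kernel y 0 = 0"
  by (simp add: levy_kernel_def)

text \<open>Inside the unit ball the kernel is the second-order Taylor remainder of the exponential;
  outside it is exp minus 1, of modulus at most 2. The constant \<open>2 + (norm y)\<^sup>2\<close>
  covers both cases.\<close>

lemma norm_levy_kernel_le:
  "cmod (levy_kernel y x) \<le> (2 + (norm y)\<^sup>2) * min 1 ((norm x)\<^sup>2)"
proof (cases "norm x < 1")
  case True
  have "cmod (levy_kernel y x) = cmod (iexp (inner y x) - (\<Sum>k\<le>1. (\<i> * inner y x)^k / fact k))"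
    using True by (simp add: levy_kernel_def diff_diff_eq)
  also have "\<dots> \<le> \<bar>inner y x\<bar>^2 / 2"
    using iexp_approx1[of "inner y x" 1] by (simp add: numeral_2_eq_2)
  also have "\<dots> \<le> (norm y * norm x)^2 / 2"
    by (intro divide_right_mono power_mono Cauchy_Schwarz_ineq2) auto
  also have "\<dots> \<le> (2 + (norm y)\<^sup>2) * (norm x)\<^sup>2"
    by (simp add: power_mult_distrib algebra_simps)
  finally show ?thesis using True by (simp add: min_absorb2 power_le_one)
next
  case False
  then have "cmod (levy_kernel y x) \<le> 2"
    using norm_triangle_ineq4[of "exp (\<i> * complex_of_real (inner y x))" 1]
    by (simp add: levy_kernel_def)
  moreover have "min 1 ((norm x)\<^sup>2) = 1" using False by (simp add: min_def one_le_power)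
  ultimately show ?thesis by (simp add: add_increasing2)
qed

section \<open>Finiteness properties of a Levy measure\<close>

locale levy_measure_space =
  fixes M :: "'h::{real_inner,complete_space,second_countable_topology} measure"
  assumes levy_measure: "levy_measure M"
begin

lemma sets_M [measurable_cong, simp]: "sets M = sets borel"
  using levy_measure by (simp add: levy_measure_def)

lemma space_M [simp]: "space M = UNIV"
  using sets_eq_imp_space_eq[OF sets_M] by simp

lemma integrable_min_norm: "integrable M (\<lambda>x. min 1 ((norm x)\<^sup>2))"
  using levy_measure by (intro integrableI_bounded) (auto simp: levy_measure_def)

text \<open>Markov's inequality: on this set the integrand \<open>min 1 ((norm x)\<^sup>2)\<close>
  is at least \<open>min 1 (\<delta>\<^sup>2)\<close>.\<close>

lemma emeasure_norm_ge_finite: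
  assumes "0 < \<delta>"
  shows "emeasure M {x. \<delta> \<le> norm x} < \<infinity>"
proof -
  let ?c = "min 1 (\<delta>\<^sup>2)"
  have c: "0 < ?c" using assms by simp
  have "ennreal ?c * emeasure M {x. \<delta> \<le> norm x} = (\<integral>\<^sup>+x. ennreal ?c * indicator {x. \<delta> \<le> norm x} x \<partial>M)"
    by (simp add: nn_integral_cmult_indicator)
  also have "\<dots> \<le> (\<integral>\<^sup>+x. ennreal (min 1 ((norm x)\<^sup>2)) \<partial>M)"
  proof (intro nn_integral_mono)
    fix x
    show "ennreal ?c * indicator {x. \<delta> \<le> norm x} x \<le> ennreal (min 1 ((norm x)\<^sup>2))"
    proof (cases "\<delta> \<le> norm x")
      case True
      then have "?c \<le> min 1 ((norm x)\<^sup>2)" using assms by (intro min.mono power_mono) auto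
      then show ?thesis using True by (simp add: ennreal_leI)
    qed simp
  qed
  also have "\<dots> < \<infinity>" using levy_measure by (simp add: levy_measure_def)
  finally show ?thesis using c by (auto simp: ennreal_mult_less_top)
qed

text \<open>The origin is a null set, and the sets |x| >= 1/(n+1), each of finite measure, exhaust
  the rest. Fubini's theorem over \<open>M\<close> rests on this.\<close>

lemma sigma_finite_M: "sigma_finite_measure M"
proof
  let ?A = "insert {0} (range (\<lambda>n. {x. 1 / real (Suc n) \<le> norm x}))"
  have "x \<in> \<Union>?A" for x :: 'h
  proof (cases "x = 0")
    case False
    then obtain n where "inverse (real (Suc n)) < norm x" using reals_Archimedean[of "norm x"] by auto
    then show ?thesis by (auto simp: inverse_eq_divide intro!: exI[of _ n])
  qed simp
  moreover have "emeasure M A \<noteq> \<infinity>" if A: "A \<in> ?A" for A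
  proof (cases "A = {0}")
    case True
    then show ?thesis using levy_measure by (simp add: levy_measure_def)
  next
    case False
    then obtain n where "A = {x. 1 / real (Suc n) \<le> norm x}" using A by auto
    then show ?thesis using emeasure_norm_ge_finite[of "1 / real (Suc n)"] by simp
  qed
  ultimately show "\<exists>A. countable A \<and> A \<subseteq> sets M \<and> \<Union>A = space M \<and> (\<forall>a\<in>A. emeasure M a \<noteq> \<infinity>)"
    by (intro exI[of _ ?A]) auto
qed

end

lemma integral_scale_measure:
  fixes f :: "'a \<Rightarrow> complex"
  assumes "0 \<le> h" "f \<in> borel_measurable M"
  shows "(LINT x|scale_measure (ennreal h) M. f x) = complex_of_real h * (LINT x|M. f x)"
proof -
  have "scale_measure (ennreal h) M = density M (\<lambda>_. ennreal h)"
    by (rule measure_eqI) (auto simp: emeasure_density nn_integral_cmult_indicator)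
  then show ?thesis using assms by (simp add: integral_density scaleR_conv_of_real)
qed

text \<open>The sum is the integral of a step function. Uniform continuity makes its distance to
  \<open>c\<close> less than \<open>e / (2 * t)\<close> on the whole interval, so the integrals
  differ by at most \<open>e / 2\<close>.\<close>

lemma riemann_sums_tendsto:
  fixes c :: "real \<Rightarrow> complex"
  assumes t: "0 < t" and c: "continuous_on {0..t} c"
    and N: "filterlim N at_top sequentially"
  shows "(\<lambda>k. complex_of_real (t / real (N k)) * (\<Sum>i<N k. c (real i * (t / real (N k))))) \<longlonglongrightarrow>
    (LINT s:{0..t}|lborel. c s)"
proof (rule metric_LIMSEQ_I)
  fix e :: real assume e: "0 < e"
  have "uniformly_continuous_on {0..t} c" using c compact_uniformly_continuous compact_Icc by blast
  then obtain d where d: "0 < d" "\<And>u v. u \<in> {0..t} \<Longrightarrow> v \<in> {0..t} \<Longrightarrow> dist v u < d \<Longrightarrow> dist (c v) (c u) < e / (2 * t)"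
    unfolding uniformly_continuous_on_def using e t by (metis divide_pos_pos mult_pos_pos zero_less_numeral)
  have c_int: "integrable lborel (\<lambda>s. indicator {0..t} s *\<^sub>R c s)"
    using borel_integrable_compact[OF _ c] by simp
  have main: "dist (complex_of_real (t / real n) * (\<Sum>i<n. c (real i * (t / real n)))) (LINT s:{0..t}|lborel. c s) < e"
    if n: "real n > t / d" for n
  proof -
    define h where "h = t / real n"
    have n0: "n > 0" using less_trans[OF divide_pos_pos[OF t d(1)] n] by simp
    have h: "0 < h" "h < d" "real n * h = t"
      using n n0 t d(1) by (auto simp: h_def field_simps)
    \<comment> \<open>Half-open cells are disjoint, so their indicators add up exactly to that of
      [0, t). The missing endpoint is a null set and is dropped in \<open>split\<close>.\<close>
    define J where "J i = {real i * h..<real (Suc i) * h}" for i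
    have J_sum: "(\<Sum>i<m. indicator (J i) s) = (indicator {0..<real m * h} s :: real)" for m s
    proof (induction m)
      case (Suc m)
      define u where "u = real m * h"
      have u: "0 \<le> u" "real (Suc m) * h = u + h" using h by (auto simp: u_def algebra_simps)
      have "indicator {0..<u + h} s = (indicator {0..<u} s + indicator {u..<u + h} s :: real)"
        using u h by (auto simp: indicator_def)
      then show ?case using Suc by (simp only: sum.lessThan_Suc J_def u(2) flip: u_def)
    qed simp
    have J_t: "J i \<subseteq> {0..t}" if "i < n" for i
    proof -
      have "real (Suc i) * h \<le> real n * h" using that h by (intro mult_right_mono) auto
      moreover have "0 \<le> real i * h" using h by simp
      ultimately show ?thesis unfolding J_def h(3) by auto
    qed
    have J_meas: "measure lborel (J i) = h" for i using h by (simp add: J_def algebra_simps)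
    have [measurable]: "J i \<in> sets borel" for i by (simp add: J_def)
    have J_fin: "emeasure lborel (J i) < \<infinity>" for i using h by (simp add: J_def algebra_simps)
    define g where "g s = (\<Sum>i<n. indicator (J i) s *\<^sub>R c (real i * h))" for s
    have g_int: "integrable lborel g"
      unfolding g_def[abs_def] using J_fin by (intro Bochner_Integration.integrable_sum integrable_scaleR_left)
        (auto intro!: integrable_real_indicator)
    have g_val: "(LINT s|lborel. g s) = complex_of_real h * (\<Sum>i<n. c (real i * h))"
      unfolding g_def using J_fin J_meas
      by (subst Bochner_Integration.integral_sum)
         (auto simp: sum_distrib_left scaleR_conv_of_real intro!: integrable_scaleR_left integrable_real_indicator)
    have split: "(LINT s:{0..t}|lborel. c s) = (LINT s|lborel. indicator {0..<t} s *\<^sub>R c s)"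
      unfolding set_lebesgue_integral_def
    proof (rule integral_cong_AE)
      have "AE s in lborel. s \<noteq> t" by (rule AE_lborel_singleton)
      then show "AE s in lborel. indicator {0..t} s *\<^sub>R c s = indicator {0..<t} s *\<^sub>R c s"
        by eventually_elim (auto simp: indicator_def)
      show "(\<lambda>s. indicator {0..<t} s *\<^sub>R c s) \<in> borel_measurable lborel"
        using borel_measurable_continuous_on_indicator[of "{0..<t}" c] continuous_on_subset[OF c, of "{0..<t}"]
        by (simp add: atLeastLessThan_subseteq_atLeastAtMost_iff)
    qed (use c_int in auto)
    have c_int': "integrable lborel (\<lambda>s. indicator {0..<t} s *\<^sub>R c s)"
    proof -
      have "(\<lambda>s. indicator {0..<t} s *\<^sub>R c s) = (\<lambda>s. indicator {0..<t} s *\<^sub>R (indicator {0..t} s *\<^sub>R c s))"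
        by (auto simp: fun_eq_iff indicator_def)
      then show ?thesis using integrable_mult_indicator[OF _ c_int, of "{0..<t}"] by simp
    qed
    have pt: "norm (g s - indicator {0..<t} s *\<^sub>R c s) \<le> e / (2 * t) * indicator {0..<t} s" for s
    proof -
      have "indicator {0..<t} s *\<^sub>R c s = (\<Sum>i<n. indicator (J i) s *\<^sub>R c s)"
        unfolding h(3)[symmetric] by (simp add: J_sum flip: scaleR_sum_left)
      then have "g s - indicator {0..<t} s *\<^sub>R c s = (\<Sum>i<n. indicator (J i) s *\<^sub>R (c (real i * h) - c s))"
        by (simp add: g_def sum_subtractf scaleR_diff_right)
      also have "norm \<dots> \<le> (\<Sum>i<n. indicator (J i) s * (e / (2 * t)))"
      proof (rule sum_norm_le)
        fix i assume i: "i \<in> {..<n}"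
        show "norm (indicator (J i) s *\<^sub>R (c (real i * h) - c s)) \<le> indicator (J i) s * (e / (2 * t))"
        proof (cases "s \<in> J i")
          case True
          have "real i * h \<in> J i" using h by (simp add: J_def)
          moreover have "dist (real i * h) s < d" using True h by (auto simp: J_def dist_real_def algebra_simps)
          ultimately have "dist (c (real i * h)) (c s) < e / (2 * t)"
            using J_t[of i] i True by (intro d(2)) auto
          then show ?thesis using True by (simp add: dist_norm)
        qed simp
      qed
      also have "\<dots> = (\<Sum>i<n. indicator (J i) s) * (e / (2 * t))"
        by (rule sum_distrib_right[symmetric])
      also have "\<dots> = e / (2 * t) * indicator {0..<t} s"
        unfolding J_sum h(3) by (rule mult.commute)
      finally show ?thesis .
    qed
    have "dist (complex_of_real h * (\<Sum>i<n. c (real i * h))) (LINT s:{0..t}|lborel. c s)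
        = norm (LINT s|lborel. g s - indicator {0..<t} s *\<^sub>R c s)"
      using g_int c_int' by (simp add: dist_norm g_val split)
    also have "\<dots> \<le> (LINT s|lborel. norm (g s - indicator {0..<t} s *\<^sub>R c s))" by simp
    also have "\<dots> \<le> (LINT s|lborel. e / (2 * t) * indicator {0..<t} s)"
    proof (rule integral_mono)
      show "integrable lborel (\<lambda>s. norm (g s - indicator {0..<t} s *\<^sub>R c s))"
        using g_int c_int' by simp
      have "integrable lborel (indicat_real {0..<t})" using t by (intro integrable_real_indicator) auto
      then show "integrable lborel (\<lambda>s. e / (2 * t) * indicat_real {0..<t} s)" by (rule integrable_mult_right)
    qed (rule pt)
    also have "\<dots> = e / 2" using t by simp
    also have "\<dots> < e" using e by simp
    finally show ?thesis by (simp add: h_def)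
  qed
  have "eventually (\<lambda>k. real (N k) > t / d) sequentially"
    using filterlim_compose[OF filterlim_real_sequentially N] by (simp add: filterlim_at_top_dense)
  then obtain k0 where "\<And>k. k \<ge> k0 \<Longrightarrow> real (N k) > t / d" by (auto simp: eventually_sequentially)
  then show "\<exists>k0. \<forall>k\<ge>k0. dist (complex_of_real (t / real (N k)) * (\<Sum>i<N k. c (real i * (t / real (N k)))))
      (LINT s:{0..t}|lborel. c s) < e"
    using main by blast
qed

section \<open>The characteristic function of the convolution\<close>

locale levy_triplet = levy_process_space P Z + levy_measure_space M
  for P :: "'w measure"
    and Z :: "real \<Rightarrow> 'w \<Rightarrow> 'h::{real_inner,complete_space,second_countable_topology}"
    and M :: "'h measure" +
  fixes a :: 'h and \<Theta> :: "'h \<Rightarrow> 'h"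
  assumes Z_char: "\<And>s. 0 \<le> s \<Longrightarrow>
    levy_char P (Z s) (s *\<^sub>R a) (\<lambda>y. s *\<^sub>R \<Theta> y) (scale_measure (ennreal s) M)"
begin

abbreviation "\<psi> \<equiv> levy_exponent a \<Theta> M"

lemma char_Z:
  assumes "0 \<le> s"
  shows "(LINT \<omega>|P. exp (\<i> * complex_of_real (inner y (Z s \<omega>)))) = exp (complex_of_real s * \<psi> y)"
proof -
  have "(LINT \<omega>|P. exp (\<i> * complex_of_real (inner y (Z s \<omega>)))) =
      exp (\<i> * complex_of_real (inner (s *\<^sub>R a) y) - complex_of_real (inner (s *\<^sub>R \<Theta> y) y / 2)
        + (LINT x|scale_measure (ennreal s) M. levy_kernel y x))"
    using Z_char[OF assms] unfolding levy_char_def levy_kernel_def by blast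
  also have "(LINT x|scale_measure (ennreal s) M. levy_kernel y x) = complex_of_real s * (LINT x|M. levy_kernel y x)"
    using assms by (intro integral_scale_measure) simp_all
  finally show ?thesis by (simp add: levy_exponent_def algebra_simps)
qed

lemma char_increment:
  assumes "0 \<le> \<delta>"
  shows "(LINT \<omega>|P. exp (\<i> * complex_of_real (inner y (increment \<delta> m \<omega>)))) = exp (complex_of_real \<delta> * \<psi> y)"
proof -
  have "(LINT \<omega>|P. exp (\<i> * complex_of_real (inner y (increment \<delta> m \<omega>)))) =
      (LINT x|distr P borel (increment \<delta> m). exp (\<i> * complex_of_real (inner y x)))"
    by (subst integral_distr[OF increment_measurable[OF assms]]) simp_all
  also have "\<dots> = (LINT \<omega>|P. exp (\<i> * complex_of_real (inner y (Z \<delta> \<omega>))))"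
    unfolding distr_increment[OF assms] by (subst integral_distr[OF Z_measurable[OF assms]]) simp_all
  finally show ?thesis using char_Z[OF assms] by simp
qed

text \<open>The adjoints move the operators onto \<open>y\<close>; the exponential of the sum is
  then a product of functions of independent increments.\<close>

lemma char_riemann_sum:
  assumes \<delta>: "0 < \<delta>" and T: "\<And>i. i < N \<Longrightarrow> bounded_linear (T i)"
  shows "(LINT \<omega>|P. exp (\<i> * complex_of_real (inner y (riemann_sum N \<delta> T \<omega>)))) =
    exp (complex_of_real \<delta> * (\<Sum>i<N. \<psi> (hadj (T i) y)))"
proof -
  let ?E = "\<lambda>i \<omega>. exp (\<i> * complex_of_real (inner (hadj (T i) y) (increment \<delta> i \<omega>)))"
  have eq: "inner y (riemann_sum N \<delta> T \<omega>) = (\<Sum>i<N. inner (hadj (T i) y) (increment \<delta> i \<omega>))" for \<omega>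
    unfolding riemann_sum_def inner_sum_right
  proof (rule sum.cong[OF refl])
    fix i assume "i \<in> {..<N}"
    then show "inner y (T i (increment \<delta> i \<omega>)) = inner (hadj (T i) y) (increment \<delta> i \<omega>)"
      by (metis T inner_commute inner_hadj lessThan_iff)
  qed
  have "(LINT \<omega>|P. exp (\<i> * complex_of_real (inner y (riemann_sum N \<delta> T \<omega>)))) = (LINT \<omega>|P. (\<Prod>i<N. ?E i \<omega>))"
    unfolding eq by (simp add: exp_sum sum_distrib_left)
  also have "\<dots> = (\<Prod>i<N. LINT \<omega>|P. ?E i \<omega>)"
  proof (rule indep_vars_lebesgue_integral)
    show "indep_vars (\<lambda>_. borel) ?E {..<N}"
      by (rule indep_vars_compose2[OF indep_increments[OF \<delta>]]) measurable
    fix i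
    have [measurable]: "increment \<delta> i \<in> borel_measurable P" using \<delta> by (intro increment_measurable) simp
    show "integrable P (?E i)"
      by (rule integrable_const_bound[where B=1]) auto
  qed simp
  also have "\<dots> = (\<Prod>i<N. exp (complex_of_real \<delta> * \<psi> (hadj (T i) y)))"
    using \<delta> by (simp add: char_increment)
  finally show ?thesis by (simp add: exp_sum sum_distrib_left)
qed

text \<open>The Gaussian part is recovered from the modulus of the characteristic function of \<open>Z 1\<close>, whose
  weak sequential continuity is plain dominated convergence.\<close>
lemma levy_exponent_weakly_continuous:
  assumes weak: "\<And>x. (\<lambda>m. inner (z m) x) \<longlonglongrightarrow> inner z0 x" and bound: "\<And>m. norm (z m) \<le> B"
  shows "(\<lambda>m. \<psi> (z m)) \<longlonglongrightarrow> \<psi> z0"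
proof -
  have I: "(\<lambda>m. LINT x|M. levy_kernel (z m) x) \<longlonglongrightarrow> (LINT x|M. levy_kernel z0 x)"
  proof (rule integral_dominated_convergence[where w="\<lambda>x. (2 + B\<^sup>2) * min 1 ((norm x)\<^sup>2)"])
    show "integrable M (\<lambda>x. (2 + B\<^sup>2) * min 1 ((norm x)\<^sup>2))" using integrable_min_norm by simp
    show "AE x in M. (\<lambda>m. levy_kernel (z m) x) \<longlonglongrightarrow> levy_kernel z0 x"
      unfolding levy_kernel_def by (intro AE_I2 tendsto_intros weak)
    show "AE x in M. norm (levy_kernel (z m) x) \<le> (2 + B\<^sup>2) * min 1 ((norm x)\<^sup>2)" for m
    proof (rule AE_I2)
      fix x :: 'h
      have "(2 + (norm (z m))\<^sup>2) * min 1 ((norm x)\<^sup>2) \<le> (2 + B\<^sup>2) * min 1 ((norm x)\<^sup>2)"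
        using bound[of m] by (intro mult_right_mono add_left_mono power_mono) auto
      with norm_levy_kernel_le show "norm (levy_kernel (z m) x) \<le> (2 + B\<^sup>2) * min 1 ((norm x)\<^sup>2)"
        by (rule order_trans)
    qed
  qed simp_all
  have [measurable]: "Z 1 \<in> borel_measurable P" by (rule Z_measurable) simp
  have "(\<lambda>m. LINT \<omega>|P. exp (\<i> * complex_of_real (inner (z m) (Z 1 \<omega>)))) \<longlonglongrightarrow>
      (LINT \<omega>|P. exp (\<i> * complex_of_real (inner z0 (Z 1 \<omega>))))"
    by (rule integral_dominated_convergence[where w="\<lambda>_. 1"]) (auto intro!: tendsto_intros weak)
  then have "(\<lambda>m. exp (\<psi> (z m))) \<longlonglongrightarrow> exp (\<psi> z0)" by (simp add: char_Z)
  \<comment> \<open>Passing to moduli avoids any choice of a branch of the complex logarithm and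
    still yields the real part of the exponent. Subtracting the real part of the jump integral
    leaves exactly the quadratic form, the drift being purely imaginary.\<close>
  then have "(\<lambda>m. ln (cmod (exp (\<psi> (z m))))) \<longlonglongrightarrow> ln (cmod (exp (\<psi> z0)))"
    by (rule tendsto_ln[OF tendsto_norm]) simp
  then have "(\<lambda>m. Re (\<psi> (z m))) \<longlonglongrightarrow> Re (\<psi> z0)" by simp
  from tendsto_diff[OF this tendsto_Re[OF I]]
  have q: "(\<lambda>m. - (inner (\<Theta> (z m)) (z m) / 2)) \<longlonglongrightarrow> - (inner (\<Theta> z0) z0 / 2)"
    by (simp add: levy_exponent_def)
  have "(\<lambda>m. \<i> * complex_of_real (inner (z m) a) + complex_of_real (- (inner (\<Theta> (z m)) (z m) / 2))
      + (LINT x|M. levy_kernel (z m) x)) \<longlonglongrightarrow>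
      \<i> * complex_of_real (inner z0 a) + complex_of_real (- (inner (\<Theta> z0) z0 / 2)) + (LINT x|M. levy_kernel z0 x)"
    by (intro tendsto_intros weak q I)
  then show ?thesis by (simp add: levy_exponent_def inner_commute[of _ a])
qed

end

section \<open>Uniformly bounded, strongly continuous paths of operators and their
  measurability\<close>

locale operator_path =
  fixes F :: "real \<Rightarrow> 'h::{real_inner,complete_space,second_countable_topology} \<Rightarrow> 'h" and t C :: real
  assumes t: "0 \<le> t" and C: "1 \<le> C"
    and bl: "\<And>s. s \<in> {0..t} \<Longrightarrow> bounded_linear (F s)"
    and bound: "\<And>s x. s \<in> {0..t} \<Longrightarrow> norm (F s x) \<le> C * norm x"
    and cont: "\<And>x. continuous_on {0..t} (\<lambda>s. F s x)"
begin

lemma norm_hadj_F: "s \<in> {0..t} \<Longrightarrow> norm (hadj (F s) y) \<le> C * norm y"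
  by (rule norm_hadj_le[OF bl bound])

lemma inner_hadj_F: "s \<in> {0..t} \<Longrightarrow> inner (hadj (F s) y) x = inner y (F s x)"
  using inner_hadj[OF bl, of s x y] by (simp add: inner_commute)

text \<open>Along s_n -> s and x_n -> x, split F(s_n) x_n into F(s_n)(x_n - x) + F(s_n) x: the
  uniform bound handles the first term, strong continuity the second.\<close>

lemma jointly_continuous: "continuous_on ({0..t} \<times> UNIV) (\<lambda>(s, x). F s x)"
  unfolding continuous_on_sequentially comp_def
proof (intro allI ballI impI, elim conjE)
  fix u :: "nat \<Rightarrow> real \<times> 'h" and p
  assume p: "p \<in> {0..t} \<times> UNIV" and u: "\<forall>n. u n \<in> {0..t} \<times> UNIV" and lim: "u \<longlonglongrightarrow> p"
  have s: "fst (u n) \<in> {0..t}" for n using u[rule_format, of n] by (auto simp: mem_Times_iff)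
  have lim1: "(\<lambda>n. F (fst (u n)) (snd p)) \<longlonglongrightarrow> F (fst p) (snd p)"
    using continuous_on_tendsto_compose[OF cont tendsto_fst[OF lim]] p s by (auto simp: mem_Times_iff)
  have "(\<lambda>n. C * norm (snd (u n) - snd p)) \<longlonglongrightarrow> C * norm (snd p - snd p)"
    by (intro tendsto_intros lim)
  then have "(\<lambda>n. C * norm (snd (u n) - snd p)) \<longlonglongrightarrow> 0" by simp
  then have lim2: "(\<lambda>n. F (fst (u n)) (snd (u n) - snd p)) \<longlonglongrightarrow> 0"
    by (rule Lim_null_comparison[rotated]) (use bound[OF s] in auto)
  have "(\<lambda>n. F (fst (u n)) (snd (u n))) = (\<lambda>n. F (fst (u n)) (snd (u n) - snd p) + F (fst (u n)) (snd p))"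
    using linear_diff[OF bounded_linear.linear[OF bl[OF s]]] by (simp add: fun_eq_iff)
  then have "(\<lambda>n. F (fst (u n)) (snd (u n))) \<longlonglongrightarrow> 0 + F (fst p) (snd p)"
    using tendsto_add[OF lim2 lim1] by simp
  then show "(\<lambda>n. case u n of (s, x) \<Rightarrow> F s x) \<longlonglongrightarrow> (case p of (s, x) \<Rightarrow> F s x)"
    by (simp add: case_prod_unfold)
qed

text \<open>Nothing is known about \<open>F\<close> outside [0, t]. Extension by zero gives a Borel
  function on the full product space, as Fubini's theorem requires, and keeps the norm bound for all
  times.\<close>

definition G :: "real \<Rightarrow> 'h \<Rightarrow> 'h" where
  "G s x = indicator {0..t} s *\<^sub>R F s x"

lemma G_eq: "s \<in> {0..t} \<Longrightarrow> G s x = F s x"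
  by (simp add: G_def)

lemma norm_G: "norm (G s x) \<le> C * norm x"
  using bound[of s x] C by (auto simp: G_def indicator_def)

lemma G_measurable_pair [measurable]: "(\<lambda>(s, x). G s x) \<in> borel_measurable (borel \<Otimes>\<^sub>M borel)"
proof -
  have "(\<lambda>p. indicator ({0..t} \<times> UNIV) p *\<^sub>R (case p of (s, x) \<Rightarrow> F s x)) \<in> borel_measurable borel"
    by (intro borel_measurable_continuous_on_indicator jointly_continuous borel_closed closed_Times) auto
  also have "(\<lambda>p. indicator ({0..t} \<times> UNIV) p *\<^sub>R (case p of (s, x) \<Rightarrow> F s x)) = (\<lambda>(s, x). G s x)"
    by (auto simp: G_def fun_eq_iff indicator_def)
  finally show ?thesis by (simp add: borel_prod)
qed

text \<open>Inner products of the adjoint path with a fixed vector are inner products of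
  \<open>G\<close> with \<open>y\<close>, so weak measurability is at hand although strong
  continuity of the adjoints is not.\<close>

lemma hadj_measurable [measurable]: "(\<lambda>s. indicator {0..t} s *\<^sub>R hadj (F s) y) \<in> borel_measurable borel"
proof (rule borel_measurable_weakI)
  fix z
  have "(\<lambda>s. inner (indicator {0..t} s *\<^sub>R hadj (F s) y) z) = (\<lambda>s. inner y (G s z))"
    by (auto simp: fun_eq_iff indicator_def G_def inner_hadj_F)
  moreover have "(\<lambda>s. inner y (G s z)) \<in> borel_measurable borel" by measurable
  ultimately show "(\<lambda>s. inner (indicator {0..t} s *\<^sub>R hadj (F s) y) z) \<in> borel_measurable borel" by simp
qed

lemma set_integrable_hilbert:
  fixes f :: "real \<Rightarrow> 'h"
  assumes "(\<lambda>s. indicator {0..t} s *\<^sub>R f s) \<in> borel_measurable borel"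
    and "\<And>s. s \<in> {0..t} \<Longrightarrow> norm (f s) \<le> K"
  shows "set_integrable lborel {0..t} f"
  unfolding set_integrable_def
proof (rule integrable_hilbert_bound[where w="\<lambda>s. K * indicator {0..t} s"])
  have "integrable lborel (indicat_real {0..t})" by (intro integrable_real_indicator) (auto simp: t)
  then show "integrable lborel (\<lambda>s. K * indicat_real {0..t} s)" by (rule integrable_mult_right)
qed (use assms in \<open>auto simp: indicator_def\<close>)

lemma set_integral_inner:
  fixes f :: "real \<Rightarrow> 'h"
  assumes "set_integrable lborel {0..t} f"
  shows "(LINT s:{0..t}|lborel. complex_of_real (inner (f s) y)) =
      complex_of_real (inner (LINT s:{0..t}|lborel. f s) y)"
    and "set_integrable lborel {0..t} (\<lambda>s. complex_of_real (inner (f s) y))"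
proof -
  have int: "integrable lborel (\<lambda>s. indicator {0..t} s *\<^sub>R f s)" using assms by (simp add: set_integrable_def)
  have eq: "indicator {0..t} s *\<^sub>R complex_of_real (inner (f s) y) =
      complex_of_real (inner (indicator {0..t} s *\<^sub>R f s) y)" for s
    by (simp add: scaleR_conv_of_real)
  show "(LINT s:{0..t}|lborel. complex_of_real (inner (f s) y)) =
      complex_of_real (inner (LINT s:{0..t}|lborel. f s) y)"
    unfolding set_lebesgue_integral_def eq integral_complex_of_real using int by (subst integral_inner_left) auto
  show "set_integrable lborel {0..t} (\<lambda>s. complex_of_real (inner (f s) y))"
    unfolding set_integrable_def eq using int by (intro integrable_of_real integrable_inner_left)
qed

end

locale levy_convolution = levy_triplet P Z M a \<Theta> + operator_path F t C
  for P :: "'w measure"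
    and Z :: "real \<Rightarrow> 'w \<Rightarrow> 'h::{real_inner,complete_space,second_countable_topology}"
    and M :: "'h measure" and a \<Theta> and F :: "real \<Rightarrow> 'h \<Rightarrow> 'h" and t C
begin

lemma exponent_continuous: "continuous_on {0..t} (\<lambda>s. \<psi> (hadj (F s) y))"
  unfolding continuous_on_sequentially comp_def
proof (intro allI ballI impI, elim conjE)
  fix u :: "nat \<Rightarrow> real" and s
  assume s: "s \<in> {0..t}" and u: "\<forall>n. u n \<in> {0..t}" and lim: "u \<longlonglongrightarrow> s"
  show "(\<lambda>n. \<psi> (hadj (F (u n)) y)) \<longlonglongrightarrow> \<psi> (hadj (F s) y)"
  proof (rule levy_exponent_weakly_continuous)
    show "(\<lambda>n. inner (hadj (F (u n)) y) x) \<longlonglongrightarrow> inner (hadj (F s) y) x" for x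
      using tendsto_inner[OF tendsto_const continuous_on_tendsto_compose[OF cont lim s], of y x] u s
      by (simp add: inner_hadj_F)
    show "norm (hadj (F (u n)) y) \<le> C * norm y" for n using u by (intro norm_hadj_F) auto
  qed
qed

lemma char_limit:
  assumes "0 < t" and [measurable]: "Y \<in> borel_measurable P"
    and conv: "\<And>e. e > 0 \<Longrightarrow> \<exists>m. \<forall>k\<ge>m. prob {\<omega>\<in>space P.
      dist (riemann_sum (2^k) (t / 2^k) (\<lambda>i. F (real i * (t / 2^k))) \<omega>) (Y \<omega>) > e} < e"
  shows "(LINT \<omega>|P. exp (\<i> * complex_of_real (inner y (Y \<omega>)))) =
    exp (LINT s:{0..t}|lborel. \<psi> (hadj (F s) y))"
proof -
  define S where "S k = riemann_sum (2^k) (t / 2^k) (\<lambda>i. F (real i * (t / 2^k)))" for k :: nat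
  have T: "bounded_linear (F (real i * (t / 2^k)))" if "i < 2^k" for k i
  proof (rule bl)
    have "real i \<le> 2^k" using that by (metis of_nat_le_iff of_nat_numeral of_nat_power less_imp_le)
    then have "real i * t \<le> 2^k * t" using t by (intro mult_right_mono) auto
    then show "real i * (t / 2^k) \<in> {0..t}" using t by (simp add: field_simps)
  qed
  have [measurable]: "S k \<in> borel_measurable P" for k
    unfolding S_def
    by (intro riemann_sum_measurable borel_measurable_continuous_onI linear_continuous_on T) (use t in auto)
  have "\<exists>m. \<forall>k\<ge>m. prob {\<omega>\<in>space P. dist (S k \<omega>) (Y \<omega>) > e} < e" if "e > 0" for e
    using conv[OF that] unfolding S_def .
  \<comment> \<open>Convergence in probability is upgraded to almost sure convergence along a
    subsequence, so that dominated convergence applies to the characteristic functions.\<close>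
  then obtain r where r: "strict_mono r"
    and S_small: "\<And>j. prob {\<omega>\<in>space P. dist (S (r j) \<omega>) (Y \<omega>) > (1/2)^j} \<le> (1/2)^j"
    by (rule geometric_subsequence) (assumption, rule that, assumption+)
  have S_lim: "AE \<omega> in P. (\<lambda>j. S (r j) \<omega>) \<longlonglongrightarrow> Y \<omega>"
    using S_small by (intro AE_tendsto_of_geometric) auto
  have lim_char: "(\<lambda>j. LINT \<omega>|P. exp (\<i> * complex_of_real (inner y (S (r j) \<omega>)))) \<longlonglongrightarrow>
      (LINT \<omega>|P. exp (\<i> * complex_of_real (inner y (Y \<omega>))))"
  proof (rule integral_dominated_convergence[where w="\<lambda>_. 1"])
    show "AE \<omega> in P. (\<lambda>j. exp (\<i> * complex_of_real (inner y (S (r j) \<omega>)))) \<longlonglongrightarrow>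
        exp (\<i> * complex_of_real (inner y (Y \<omega>)))"
      using S_lim by eventually_elim (intro tendsto_intros)
  qed auto
  have char_S: "(LINT \<omega>|P. exp (\<i> * complex_of_real (inner y (S k \<omega>)))) =
      exp (complex_of_real (t / real (2^k)) * (\<Sum>i<2^k. \<psi> (hadj (F (real i * (t / real (2^k)))) y)))" for k
    unfolding S_def using char_riemann_sum[OF _ T, of "t / 2^k"] \<open>0 < t\<close> by simp
  have lim_sum: "(\<lambda>j. complex_of_real (t / real (2^r j)) *
      (\<Sum>i<2^r j. \<psi> (hadj (F (real i * (t / real (2^r j)))) y))) \<longlonglongrightarrow> (LINT s:{0..t}|lborel. \<psi> (hadj (F s) y))"
  proof (rule riemann_sums_tendsto[OF \<open>0 < t\<close> exponent_continuous])
    have "filterlim (\<lambda>k::nat. (2::nat)^k) at_top sequentially"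
      by (intro filterlim_subseq) (simp add: strict_mono_def)
    then show "filterlim (\<lambda>j. (2::nat)^r j) at_top sequentially"
      using filterlim_compose filterlim_subseq[OF r] by blast
  qed
  show ?thesis
    using lim_char unfolding char_S by (rule LIMSEQ_unique[OF _ tendsto_exp[OF lim_sum]])
qed

end

section \<open>The characteristics of the convolution\<close>

context levy_convolution
begin

definition correction :: "real \<Rightarrow> 'h \<Rightarrow> 'h" where
  "correction s x = (indicator {x. norm (F s x) < 1} x - indicator {x. norm x < 1} x) *\<^sub>R F s x"

definition drift_correction :: "real \<Rightarrow> 'h" where
  "drift_correction s = (LINT x|M. correction s x)"

text \<open>The exponentials on both sides agree because <F(s)* y, x> = <y, F(s) x>. Only the
  truncation terms differ, and their difference is the inner product of
  \<open>correction s x\<close> with \<open>y\<close>.\<close>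

lemma levy_kernel_hadj:
  assumes "s \<in> {0..t}"
  shows "levy_kernel (hadj (F s) y) x = levy_kernel y (G s x) + \<i> * complex_of_real (inner (correction s x) y)"
  using assms
  by (simp add: levy_kernel_def correction_def inner_hadj_F G_eq inner_commute[of _ y] indicator_def)

text \<open>For |x| < 1/C both |x| and |F(s) x| are below 1 because \<open>1 \<le> C\<close>, so the
  indicators cancel. Where they disagree, |F(s) x| is below 1 or at most \<open>C\<close>. The
  result is a dominating function of finite \<open>M\<close>-integral that does not depend on
  \<open>s\<close>.\<close>

lemma norm_correction:
  assumes s: "s \<in> {0..t}"
  shows "norm (correction s x) \<le> C * indicator {x. 1 / C \<le> norm x} x"
proof (cases "1 / C \<le> norm x")
  case True
  have "norm (correction s x) \<le> C"
  proof (cases "norm (F s x) < 1")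
    case True
    then have "norm (correction s x) \<le> norm (F s x)" by (simp add: correction_def indicator_def)
    then show ?thesis using True C by linarith
  next
    case False
    have "norm (F s x) \<le> C" if "norm x < 1"
    proof -
      have "C * norm x \<le> C * 1" using that C by (intro mult_left_mono) auto
      then show ?thesis using bound[OF s, of x] by simp
    qed
    with False C show ?thesis by (auto simp: correction_def indicator_def)
  qed
  then show ?thesis using True by simp
next
  case False
  then have "C * norm x < 1" using C by (simp add: field_simps)
  moreover have "norm x \<le> C * norm x" using C by (simp add: mult_le_cancel_right1)
  ultimately show ?thesis using bound[OF s, of x] False by (simp add: correction_def)
qed

text \<open>A version of \<open>correction\<close> that is jointly measurable on the whole product
  space; the two agree for times in [0, t].\<close>

definition G_correction :: "real \<Rightarrow> 'h \<Rightarrow> 'h" where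
  "G_correction s x = (indicator {x. norm x < 1} (G s x) - indicator {x. norm x < 1} x) *\<^sub>R G s x"

lemma G_correction_eq: "s \<in> {0..t} \<Longrightarrow> G_correction s x = correction s x"
  by (simp add: G_correction_def correction_def G_eq indicator_def)

lemma G_correction_measurable [measurable]:
  "(\<lambda>(s, x). G_correction s x) \<in> borel_measurable (borel \<Otimes>\<^sub>M borel)"
  unfolding G_correction_def by measurable

lemma integrable_norm_ge: "integrable M (\<lambda>x. C * indicat_real {x. 1 / C \<le> norm x} x)"
proof -
  have "integrable M (indicat_real {x. 1 / C \<le> norm x})"
    using emeasure_norm_ge_finite[of "1 / C"] C by (intro integrable_real_indicator) auto
  then show ?thesis by (rule integrable_mult_right)
qed

lemma integrable_correction:
  assumes s: "s \<in> {0..t}"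
  shows "integrable M (correction s)"
proof (rule integrable_hilbert_bound[OF _ integrable_norm_ge])
  have "(\<lambda>x. G_correction s x) \<in> borel_measurable M" by measurable
  also have "(\<lambda>x. G_correction s x) = correction s" using s by (simp add: G_correction_eq fun_eq_iff)
  finally show "correction s \<in> borel_measurable M" .
qed (rule norm_correction[OF s])

lemma inner_drift_correction:
  "s \<in> {0..t} \<Longrightarrow> inner (drift_correction s) y = (LINT x|M. inner (correction s x) y)"
  unfolding drift_correction_def by (rule integral_inner_left[symmetric]) (rule integrable_correction)

text \<open>Scalar parameter integrals give measurability of all inner products, hence of the vector
  function; the bound comes from the dominating function, which is the same for all
  \<open>s\<close>.\<close>

lemma set_integrable_drift_correction: "set_integrable lborel {0..t} drift_correction"
proof (rule set_integrable_hilbert)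
  interpret M: sigma_finite_measure M by (rule sigma_finite_M)
  show "(\<lambda>s. indicator {0..t} s *\<^sub>R drift_correction s) \<in> borel_measurable borel"
  proof (rule borel_measurable_weakI)
    fix z
    have "(\<lambda>s. indicator {0..t} s * (LINT x|M. inner (G_correction s x) z)) \<in> borel_measurable borel"
      by measurable
    moreover have "(\<lambda>s. inner (indicator {0..t} s *\<^sub>R drift_correction s) z) =
        (\<lambda>s. indicator {0..t} s * (LINT x|M. inner (G_correction s x) z))"
      by (auto simp: fun_eq_iff indicator_def inner_drift_correction G_correction_eq)
    ultimately show "(\<lambda>s. inner (indicator {0..t} s *\<^sub>R drift_correction s) z) \<in> borel_measurable borel"
      by simp
  qed
  fix s assume s: "s \<in> {0..t}"
  have "ennreal (norm (drift_correction s)) \<le> (\<integral>\<^sup>+x. norm (correction s x) \<partial>M)"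
    unfolding drift_correction_def by (rule integral_norm_bound_ennreal[OF integrable_correction[OF s]])
  also have "\<dots> \<le> (\<integral>\<^sup>+x. ennreal (C * indicator {x. 1 / C \<le> norm x} x) \<partial>M)"
    by (intro nn_integral_mono ennreal_leI norm_correction s)
  also have "\<dots> = ennreal (LINT x|M. C * indicator {x. 1 / C \<le> norm x} x)"
    using C by (intro nn_integral_eq_integral integrable_norm_ge) auto
  finally show "norm (drift_correction s) \<le> (LINT x|M. C * indicator {x. 1 / C \<le> norm x} x)"
    using C by (subst (asm) ennreal_le_iff) (auto intro!: integral_nonneg)
qed

section \<open>The jump measure of the convolution\<close>

definition time_measure :: "real measure" where
  "time_measure = density lborel (\<lambda>s. ennreal (indicator {0..t} s))"

text \<open>The image of ds times \<open>M\<close> under (s, x) -> F(s) x, with the origin removed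
  by a density. Removal matters because an operator with a nontrivial kernel can send jumps to 0,
  whereas a jump measure must not charge the origin.\<close>

definition convolution_measure :: "'h measure" where
  "convolution_measure =
    density (distr (time_measure \<Otimes>\<^sub>M M) borel (\<lambda>(s, x). G s x)) (\<lambda>x. ennreal (indicator (- {0}) x))"

lemma sets_time_measure [measurable_cong, simp]: "sets time_measure = sets borel"
  by (simp add: time_measure_def)

lemma finite_time_measure: "finite_measure time_measure"
proof
  have "emeasure time_measure (space time_measure) = (\<integral>\<^sup>+s. indicator {0..t} s \<partial>lborel)"
    by (simp add: time_measure_def emeasure_density ennreal_indicator)
  also have "\<dots> < \<infinity>" using t by simp
  finally show "emeasure time_measure (space time_measure) \<noteq> \<infinity>" by simp
qed

lemma G_measurable_product [measurable]: "(\<lambda>(s, x). G s x) \<in> borel_measurable (time_measure \<Otimes>\<^sub>M M)"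
  using G_measurable_pair
  by (subst measurable_cong_sets[OF sets_pair_measure_cong[OF sets_time_measure sets_M] refl])

lemma sets_convolution_measure: "sets convolution_measure = sets borel"
  by (simp add: convolution_measure_def)

lemma convolution_measure_zero: "emeasure convolution_measure {0} = 0"
  unfolding convolution_measure_def
  by (subst emeasure_density) (auto intro!: nn_integral_zero' AE_I2 simp: indicator_def)

lemma emeasure_convolution_measure:
  assumes [measurable]: "B \<in> sets borel" and "0 \<notin> B"
  shows "emeasure convolution_measure B = (\<integral>\<^sup>+s\<in>{0..t}. emeasure M {x\<in>space M. F s x \<in> B} \<partial>lborel)"
proof -
  interpret M: sigma_finite_measure M by (rule sigma_finite_M)
  let ?D = "distr (time_measure \<Otimes>\<^sub>M M) borel (\<lambda>(s, x). G s x)"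
  let ?A = "(\<lambda>(s, x). G s x) -` B \<inter> space (time_measure \<Otimes>\<^sub>M M)"
  have A: "?A \<in> sets (time_measure \<Otimes>\<^sub>M M)" by (rule measurable_sets) (use assms in measurable)
  have "emeasure convolution_measure B = (\<integral>\<^sup>+x. ennreal (indicator (- {0}) x) * indicator B x \<partial>?D)"
    unfolding convolution_measure_def by (subst emeasure_density) auto
  also have "\<dots> = (\<integral>\<^sup>+x. indicator B x \<partial>?D)"
    using \<open>0 \<notin> B\<close> by (intro nn_integral_cong) (auto simp: indicator_def)
  also have "\<dots> = emeasure (time_measure \<Otimes>\<^sub>M M) ?A"
    by (simp add: emeasure_distr)
  also have "\<dots> = (\<integral>\<^sup>+s. emeasure M (Pair s -` ?A) \<partial>time_measure)"
    using A by (rule M.emeasure_pair_measure_alt)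
  also have "\<dots> = (\<integral>\<^sup>+s. ennreal (indicator {0..t} s) * emeasure M (Pair s -` ?A) \<partial>lborel)"
    unfolding time_measure_def
    by (rule nn_integral_density) (use M.measurable_emeasure_Pair[OF A] in \<open>auto simp: time_measure_def\<close>)
  also have "\<dots> = (\<integral>\<^sup>+s\<in>{0..t}. emeasure M {x\<in>space M. F s x \<in> B} \<partial>lborel)"
  proof (intro nn_integral_cong)
    fix s
    have "Pair s -` ?A = {x\<in>space M. F s x \<in> B}" if "s \<in> {0..t}"
      using that by (auto simp: G_eq space_pair_measure time_measure_def)
    then show "ennreal (indicator {0..t} s) * emeasure M (Pair s -` ?A) =
        emeasure M {x\<in>space M. F s x \<in> B} * indicator {0..t} s"
      by (auto simp: indicator_def)
  qed
  finally show ?thesis .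
qed

text \<open>From \<open>1 \<le> C\<close> follows min(1, C^2 u) <= C^2 min(1, u). The bound is free
  of \<open>s\<close>, which gives integrability over the finite \<open>time_measure\<close> as
  well.\<close>

lemma levy_kernel_G_bound: "cmod (levy_kernel y (G s x)) \<le> (2 + (norm y)\<^sup>2) * (C\<^sup>2 * min 1 ((norm x)\<^sup>2))"
proof -
  have "(norm (G s x))\<^sup>2 \<le> (C * norm x)\<^sup>2" by (intro power_mono norm_G) simp
  moreover have "1 \<le> C\<^sup>2" using C by (simp add: one_le_power)
  ultimately have "min 1 ((norm (G s x))\<^sup>2) \<le> C\<^sup>2 * min 1 ((norm x)\<^sup>2)"
    by (auto simp: min_def power_mult_distrib)
  then have "(2 + (norm y)\<^sup>2) * min 1 ((norm (G s x))\<^sup>2) \<le> (2 + (norm y)\<^sup>2) * (C\<^sup>2 * min 1 ((norm x)\<^sup>2))"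
    by (intro mult_left_mono) auto
  with norm_levy_kernel_le show ?thesis by (rule order_trans)
qed

lemma integrable_levy_kernel_G: "integrable M (\<lambda>x. levy_kernel y (G s x))"
proof (rule Bochner_Integration.integrable_bound)
  show "integrable M (\<lambda>x. (2 + (norm y)\<^sup>2) * (C\<^sup>2 * min 1 ((norm x)\<^sup>2)))"
    by (intro integrable_mult_right integrable_min_norm)
  show "AE x in M. norm (levy_kernel y (G s x)) \<le> norm ((2 + (norm y)\<^sup>2) * (C\<^sup>2 * min 1 ((norm x)\<^sup>2)))"
    by (intro AE_I2 order_trans[OF levy_kernel_G_bound]) simp
qed measurable

lemma integral_convolution_measure:
  "(LINT x|convolution_measure. levy_kernel y x) = (LINT s:{0..t}|lborel. (LINT x|M. levy_kernel y (G s x)))"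
  "set_integrable lborel {0..t} (\<lambda>s. LINT x|M. levy_kernel y (G s x))"
proof -
  interpret M: sigma_finite_measure M by (rule sigma_finite_M)
  interpret T: finite_measure time_measure by (rule finite_time_measure)
  interpret pair_sigma_finite time_measure M ..
  have [measurable]: "(\<lambda>(s, x). levy_kernel y (G s x)) \<in> borel_measurable (time_measure \<Otimes>\<^sub>M M)"
    by measurable
  have int: "integrable (time_measure \<Otimes>\<^sub>M M) (\<lambda>(s, x). levy_kernel y (G s x))"
  proof (rule Fubini_integrable)
    show "integrable time_measure (\<lambda>s. LINT x|M. norm (case (s, x) of (s, x) \<Rightarrow> levy_kernel y (G s x)))"
    proof (rule T.integrable_const_bound)
      show "AE s in time_measure. norm (LINT x|M. norm (case (s, x) of (s, x) \<Rightarrow> levy_kernel y (G s x)))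
          \<le> (LINT x|M. (2 + (norm y)\<^sup>2) * (C\<^sup>2 * min 1 ((norm x)\<^sup>2)))"
      proof (rule AE_I2)
        fix s
        have "norm (LINT x|M. norm (levy_kernel y (G s x))) = (LINT x|M. norm (levy_kernel y (G s x)))"
          by (simp add: integral_nonneg)
        also have "\<dots> \<le> (LINT x|M. (2 + (norm y)\<^sup>2) * (C\<^sup>2 * min 1 ((norm x)\<^sup>2)))"
          by (intro integral_mono integrable_norm integrable_levy_kernel_G integrable_mult_right
              integrable_min_norm levy_kernel_G_bound)
        finally show "norm (LINT x|M. norm (case (s, x) of (s, x) \<Rightarrow> levy_kernel y (G s x)))
            \<le> (LINT x|M. (2 + (norm y)\<^sup>2) * (C\<^sup>2 * min 1 ((norm x)\<^sup>2)))" by simp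
      qed
    qed measurable
    show "AE s in time_measure. integrable M (\<lambda>x. case (s, x) of (s, x) \<Rightarrow> levy_kernel y (G s x))"
      using integrable_levy_kernel_G by simp
  qed measurable
  have meas [measurable]: "(\<lambda>s. LINT x|M. levy_kernel y (G s x)) \<in> borel_measurable borel"
    by measurable
  have "(LINT x|convolution_measure. levy_kernel y x) =
      (LINT x|distr (time_measure \<Otimes>\<^sub>M M) borel (\<lambda>(s, x). G s x). indicat_real (- {0}) x *\<^sub>R levy_kernel y x)"
    unfolding convolution_measure_def by (rule integral_density) auto
  \<comment> \<open>The kernel vanishes at 0, so the removed mass at the origin contributes nothing,
    however large it is.\<close>
  also have "\<dots> = (LINT x|distr (time_measure \<Otimes>\<^sub>M M) borel (\<lambda>(s, x). G s x). levy_kernel y x)"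
    by (intro Bochner_Integration.integral_cong) (auto simp: indicator_def)
  also have "\<dots> = (LINT p|(time_measure \<Otimes>\<^sub>M M). (case p of (s, x) \<Rightarrow> levy_kernel y (G s x)))"
    by (subst integral_distr) (auto simp: case_prod_unfold)
  also have "\<dots> = (LINT s|time_measure. LINT x|M. levy_kernel y (G s x))"
    using integral_fst'[OF int] by simp
  also have "\<dots> = (LINT s:{0..t}|lborel. (LINT x|M. levy_kernel y (G s x)))"
    unfolding time_measure_def set_lebesgue_integral_def by (rule integral_density) auto
  finally show "(LINT x|convolution_measure. levy_kernel y x) =
      (LINT s:{0..t}|lborel. (LINT x|M. levy_kernel y (G s x)))" .
  have "integrable time_measure (\<lambda>s. LINT x|M. levy_kernel y (G s x))"
    using integrable_fst'[OF int] by simp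
  then show "set_integrable lborel {0..t} (\<lambda>s. LINT x|M. levy_kernel y (G s x))"
    unfolding time_measure_def set_integrable_def by (subst (asm) integrable_density) auto
qed

text \<open>At each time the exponent at \<open>hadj (F s) y\<close> splits into the four terms
  below, with the quadratic form of \<open>\<Theta>\<close> rewritten as that of F(s)
  \<open>\<Theta>\<close> F(s)*. Each term is integrable in \<open>s\<close> by itself, so they
  integrate separately.\<close>

lemma integral_exponent:
  assumes \<Theta>: "bounded_linear \<Theta>"
  shows "(LINT s:{0..t}|lborel. \<psi> (hadj (F s) y)) =
    \<i> * complex_of_real (inner ((LINT s:{0..t}|lborel. F s a) + (LINT s:{0..t}|lborel. drift_correction s)) y)
    - complex_of_real (inner (LINT s:{0..t}|lborel. F s (\<Theta> (hadj (F s) y))) y / 2)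
    + (LINT x|convolution_measure. levy_kernel y x)"
proof -
  have int_a: "set_integrable lborel {0..t} (\<lambda>s. F s a)"
  proof (rule set_integrable_hilbert)
    have "(\<lambda>s. G s a) \<in> borel_measurable borel" by measurable
    then show "(\<lambda>s. indicator {0..t} s *\<^sub>R F s a) \<in> borel_measurable borel" by (simp add: G_def)
  qed (rule bound)
  obtain K where K: "\<And>x. norm (\<Theta> x) \<le> norm x * K" "0 \<le> K"
    using bounded_linear.nonneg_bounded[OF \<Theta>] by blast
  have int_Q: "set_integrable lborel {0..t} (\<lambda>s. F s (\<Theta> (hadj (F s) y)))"
  proof (rule set_integrable_hilbert)
    have [measurable]: "\<Theta> \<in> borel_measurable borel"
      by (intro borel_measurable_continuous_onI linear_continuous_on \<Theta>)
    have "(\<lambda>s. G s (\<Theta> (indicator {0..t} s *\<^sub>R hadj (F s) y))) \<in> borel_measurable borel" by measurable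
    moreover have "G s (\<Theta> (indicator {0..t} s *\<^sub>R hadj (F s) y)) = indicator {0..t} s *\<^sub>R F s (\<Theta> (hadj (F s) y))" for s
      by (simp add: G_def indicator_def)
    ultimately show "(\<lambda>s. indicator {0..t} s *\<^sub>R F s (\<Theta> (hadj (F s) y))) \<in> borel_measurable borel" by simp
    fix s assume s: "s \<in> {0..t}"
    have "norm (F s (\<Theta> (hadj (F s) y))) \<le> C * norm (\<Theta> (hadj (F s) y))" by (rule bound[OF s])
    also have "\<dots> \<le> C * (norm (hadj (F s) y) * K)" using C K by (intro mult_left_mono) auto
    also have "\<dots> \<le> C * (C * norm y * K)" using C K norm_hadj_F[OF s] by (intro mult_left_mono mult_right_mono) auto
    finally show "norm (F s (\<Theta> (hadj (F s) y))) \<le> C * (C * norm y * K)" .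
  qed
  let ?A = "\<lambda>s. complex_of_real (inner (F s a) y)"
  let ?Q = "\<lambda>s. complex_of_real (inner (F s (\<Theta> (hadj (F s) y))) y)"
  let ?D = "\<lambda>s. complex_of_real (inner (drift_correction s) y)"
  let ?K = "\<lambda>s. LINT x|M. levy_kernel y (G s x)"
  note A = set_integral_inner[OF int_a, of y] and Q = set_integral_inner[OF int_Q, of y]
    and D = set_integral_inner[OF set_integrable_drift_correction, of y] and L = integral_convolution_measure[of y]
  have "\<psi> (hadj (F s) y) = \<i> * ?A s - ?Q s / 2 + ?K s + \<i> * ?D s" if s: "s \<in> {0..t}" for s
  proof -
    have "(LINT x|M. levy_kernel (hadj (F s) y) x) =
        (LINT x|M. levy_kernel y (G s x) + \<i> * complex_of_real (inner (correction s x) y))"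
      by (simp add: levy_kernel_hadj[OF s])
    also have "\<dots> = ?K s + (LINT x|M. \<i> * complex_of_real (inner (correction s x) y))"
      by (intro Bochner_Integration.integral_add integrable_levy_kernel_G integrable_mult_right
          integrable_of_real integrable_inner_left integrable_correction s)
    also have "(LINT x|M. \<i> * complex_of_real (inner (correction s x) y)) = \<i> * ?D s"
      by (simp add: inner_drift_correction[OF s])
    finally have "(LINT x|M. levy_kernel (hadj (F s) y) x) = ?K s + \<i> * ?D s" .
    moreover have "inner a (hadj (F s) y) = inner (F s a) y"
      "inner (\<Theta> (hadj (F s) y)) (hadj (F s) y) = inner (F s (\<Theta> (hadj (F s) y))) y"
      by (simp_all add: inner_hadj[OF bl[OF s]])
    ultimately show ?thesis by (simp add: levy_exponent_def)
  qed
  then have "(LINT s:{0..t}|lborel. \<psi> (hadj (F s) y)) =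
      (LINT s:{0..t}|lborel. \<i> * ?A s - ?Q s / 2 + ?K s + \<i> * ?D s)"
    by (intro set_lebesgue_integral_cong) auto
  also have "\<dots> = \<i> * (LINT s:{0..t}|lborel. ?A s) - (LINT s:{0..t}|lborel. ?Q s) / 2
      + (LINT s:{0..t}|lborel. ?K s) + \<i> * (LINT s:{0..t}|lborel. ?D s)"
    using A(2) Q(2) L(2) D(2) by (simp add: set_integral_add set_integral_diff)
  finally show ?thesis
    unfolding A(1) Q(1) D(1) L(1)[symmetric] by (simp add: inner_add_left algebra_simps)
qed

end

section \<open>Specialisation to the resolvent family\<close>

theorem theorem4:
  fixes P :: "'w measure"
    and Z :: "real \<Rightarrow> 'w \<Rightarrow> 'h::{real_inner,complete_space,second_countable_topology}"
    and a :: 'h and \<Theta> :: "'h \<Rightarrow> 'h" and M :: "'h measure"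
    and k :: "real \<Rightarrow> real" and A :: "'h \<Rightarrow> 'h" and D :: "'h set"
    and R :: "real \<Rightarrow> 'h \<Rightarrow> 'h"
  assumes lp: "levy_process P Z"
    and Theta: "nonneg_sym_trace_class \<Theta>"
    and LM: "levy_measure M"
    and Zchar: "\<And>t. t \<ge> 0 \<Longrightarrow> infinitely_divisible P (Z t)
                 \<and> levy_char P (Z t) (t *\<^sub>R a) (\<lambda>y. t *\<^sub>R \<Theta> y) (scale_measure (ennreal t) M)"
    and A: "closed_dense_op A D"
    and kernel: "\<And>T. T \<ge> 0 \<Longrightarrow> set_integrable lborel {0..T} k"
    and res: "resolvent_family k A D R"
    and t: "t \<ge> 0"
    and Ymeas: "Y \<in> borel_measurable P"
    and Yconv: "is_stoch_conv P R Z t Y"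
  shows "infinitely_divisible P Y \<and>
    (\<exists>MM. sets MM = sets borel \<and> emeasure MM {0} = 0
      \<and> (\<forall>B\<in>sets borel. 0 \<notin> B \<longrightarrow>
           emeasure MM B = (\<integral>\<^sup>+s\<in>{0..t}. emeasure M {x\<in>space M. R (t - s) x \<in> B} \<partial>lborel))
      \<and> levy_char P Y
          ((LINT s:{0..t}|lborel. R (t - s) a)
           + (LINT s:{0..t}|lborel. (LINT x|M.
                (indicator {x. norm (R (t - s) x) < 1} x - indicator {x. norm x < 1} x) *\<^sub>R R (t - s) x)))
          (\<lambda>y. LINT s:{0..t}|lborel. R (t - s) (\<Theta> (hadj (R (t - s)) y)))
          MM)"
proof -
  interpret levy_process_space P Z
    using lp by (intro levy_process_space.intro levy_process_space_axioms.intro)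
      (auto simp: levy_process_def)
  obtain C0 where C0: "\<And>s x. s \<in> {0..t} \<Longrightarrow> norm (R s x) \<le> C0 * norm x"
    using res t unfolding resolvent_family_def by meson
  have R_bl: "bounded_linear (R s)" if "0 \<le> s" for s
    using res that by (auto simp: resolvent_family_def)
  have R_cont: "continuous_on {0..} (\<lambda>s. R s x)" for x
    using res by (auto simp: resolvent_family_def)
  \<comment> \<open>The path is the time-reversed resolvent. Taking the maximum with 1 meets the
    requirement \<open>1 \<le> C\<close> of the path locale.\<close>
  interpret levy_convolution P Z M a \<Theta> "\<lambda>s. R (t - s)" t "max 1 C0"
  proof (intro levy_convolution.intro levy_triplet.intro levy_triplet_axioms.intro levy_measure_space.intro
      operator_path.intro levy_process_space_axioms)
    show "levy_measure M" by fact
    show "levy_char P (Z s) (s *\<^sub>R a) (\<lambda>y. s *\<^sub>R \<Theta> y) (scale_measure (ennreal s) M)" if "0 \<le> s" for s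
      using Zchar[OF that] by simp
    show "0 \<le> t" by fact
    show "bounded_linear (R (t - s))" if "s \<in> {0..t}" for s using that by (intro R_bl) auto
    show "norm (R (t - s) x) \<le> max 1 C0 * norm x" if "s \<in> {0..t}" for s x
      using C0[of "t - s" x] that mult_right_mono[of C0 "max 1 C0" "norm x"] by auto
    show "continuous_on {0..t} (\<lambda>s. R (t - s) x)" for x
      by (rule continuous_on_compose2[OF R_cont]) (auto intro!: continuous_intros)
  qed simp
  have "infinitely_divisible P Y \<and> (\<forall>y. (LINT \<omega>|P. exp (\<i> * complex_of_real (inner y (Y \<omega>)))) =
      exp (LINT s:{0..t}|lborel. levy_exponent a \<Theta> M (hadj (R (t - s)) y)))"
  \<comment> \<open>At time 0 the convolution is defined separately as the empty integral: the law
    of \<open>Y\<close> is the unit mass at 0, and all time integrals run over a null set.\<close>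
  proof (cases "t = 0")
    case True
    then have Y: "AE \<omega> in P. Y \<omega> = 0" using Yconv by (simp add: is_stoch_conv_def)
    have "infinitely_divisible P Y"
      unfolding infinitely_divisible_def
    proof (intro allI impI)
      fix n :: nat assume n: "n \<ge> 1"
      interpret Pi: product_prob_space "\<lambda>_. P" "{..<n}" ..
      have "distr P borel Y = distr P borel (\<lambda>_. 0)"
        by (intro distr_cong_AE) (use Y Ymeas in auto)
      also have "\<dots> = return borel 0" by (rule distr_const) simp
      also have "\<dots> = distr (PiM {..<n} (\<lambda>_. P)) borel (\<lambda>\<omega>. \<Sum>j<n. 0)" by (simp add: Pi.distr_const)
      also have "\<dots> = mconv_pow (distr P borel (\<lambda>_. 0)) n" by (subst mconv_pow_distr[OF _ n]) auto
      finally show "\<exists>\<mu>. prob_space \<mu> \<and> sets \<mu> = sets borel \<and> distr P borel Y = mconv_pow \<mu> n"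
        by (intro exI[of _ "distr P borel (\<lambda>_. 0)"]) (auto intro: prob_space_return)
    qed
    moreover have "(LINT \<omega>|P. exp (\<i> * complex_of_real (inner y (Y \<omega>)))) = 1" for y
    proof -
      have "(LINT \<omega>|P. exp (\<i> * complex_of_real (inner y (Y \<omega>)))) = (LINT \<omega>|P. 1)"
        using Ymeas by (intro integral_cong_AE) (use Y in auto)
      then show ?thesis by (simp add: prob_space)
    qed
    moreover have "(LINT s:{0..t}|lborel. f s) = 0" for f :: "real \<Rightarrow> complex"
    proof -
      have "AE s in lborel. s \<noteq> (0::real)" by (rule AE_lborel_singleton)
      then have "AE s in lborel. indicator {0..t} s *\<^sub>R f s = 0"
        by eventually_elim (simp add: True)
      then show ?thesis unfolding set_lebesgue_integral_def by (rule integral_eq_zero_AE)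
    qed
    ultimately show ?thesis by simp
  next
    case False
    with t have t0: "0 < t" by simp
    have conv: "\<exists>m. \<forall>k\<ge>m. prob {\<omega>\<in>space P.
        dist (riemann_sum (2^k) (t / 2^k) (\<lambda>i. R (t - real i * (t / 2^k))) \<omega>) (Y \<omega>) > e} < e"
      if e: "e > 0" for e
    proof -
      obtain \<delta> where \<delta>: "\<delta> > 0" "\<And>n ts ss. tagged_partition t \<delta> n ts ss \<Longrightarrow>
          prob {\<omega>\<in>space P. dist (conv_sum R Z t n ts ss \<omega>) (Y \<omega>) > e} < e"
        using Yconv e False unfolding is_stoch_conv_def by auto
      have "(\<lambda>k. t * (1 / 2)^k) \<longlonglongrightarrow> t * 0"
        by (intro tendsto_intros LIMSEQ_power_zero) simp
      then have "eventually (\<lambda>k. t * (1 / 2)^k < \<delta>) sequentially"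
        using \<delta>(1) by (intro order_tendstoD) auto
      then obtain m where m: "\<And>k. k \<ge> m \<Longrightarrow> t * (1 / 2)^k < \<delta>" by (auto simp: eventually_sequentially)
      have "prob {\<omega>\<in>space P.
          dist (riemann_sum (2^k) (t / 2^k) (\<lambda>i. R (t - real i * (t / 2^k))) \<omega>) (Y \<omega>) > e} < e"
        if k: "k \<ge> m" for k
      proof -
        define n :: nat where "n = 2^k"
        define h where "h = t / 2^k"
        have h: "0 < h" "h < \<delta>" "real n * h = t"
          using t0 m[OF k] by (auto simp: h_def n_def field_simps power_one_over)
        \<comment> \<open>Tags at right endpoints. The substitution \<open>i\<close> ->
          \<open>n - i\<close> reverses time, so they become left endpoints of the forward grid, and
          the indices 1 to \<open>n\<close> become \<open>n - 1\<close> down to 0 as in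
          \<open>riemann_sum\<close>.\<close>
        have tp: "tagged_partition t \<delta> n (\<lambda>i. real i * h) (\<lambda>i. real i * h)"
          unfolding tagged_partition_def using h by (auto simp: n_def of_nat_diff algebra_simps)
        have "conv_sum R Z t n (\<lambda>i. real i * h) (\<lambda>i. real i * h) \<omega>
            = riemann_sum n h (\<lambda>i. R (t - real i * h)) \<omega>" for \<omega>
          unfolding conv_sum_def riemann_sum_def increment_def
        proof (rule sum.reindex_bij_witness[of _ "\<lambda>j. n - j" "\<lambda>i. n - i"])
          fix i assume i: "i \<in> {1..n}"
          then have "t - real (n - i) * h = real i * h" "real (Suc (n - i)) * h = t - real (i - 1) * h"
            "real (n - i) * h = t - real i * h"
            by (auto simp: of_nat_diff algebra_simps h(3)[symmetric])
          then show "R (t - real (n - i) * h) (Z (real (Suc (n - i)) * h) \<omega> - Z (real (n - i) * h) \<omega>) =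
              R (real i * h) (Z (t - real (i - 1) * h) \<omega> - Z (t - real i * h) \<omega>)" by simp
        qed auto
        with \<delta>(2)[OF tp] show ?thesis by (simp add: n_def h_def)
      qed
      then show ?thesis by blast
    qed
    show ?thesis
      using infinitely_divisible_limit[OF t0 bl Ymeas conv] char_limit[OF t0 Ymeas conv] by blast
  qed
  moreover have "bounded_linear \<Theta>" using Theta by (simp add: nonneg_sym_trace_class_def)
  ultimately have id: "infinitely_divisible P Y" and char: "levy_char P Y
      ((LINT s:{0..t}|lborel. R (t - s) a) + (LINT s:{0..t}|lborel. drift_correction s))
      (\<lambda>y. LINT s:{0..t}|lborel. R (t - s) (\<Theta> (hadj (R (t - s)) y))) convolution_measure"
    by (simp_all add: levy_char_def integral_exponent levy_kernel_def)
  show ?thesis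
    using id char emeasure_convolution_measure sets_convolution_measure convolution_measure_zero
    unfolding drift_correction_def correction_def
    by (intro conjI exI[of _ convolution_measure]) auto
qed

end
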